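(* Suppose that for every uniform oriented matroid $\mathcal{M}=(E,\mathcal{C}^* )$ (of rank $r$ on $n=|E|$ elements) and every tope $T$ of $\mathcal{M}$, any two cocircuits $X,Y\in T$ are connected in the cocircuit graph $G_{\mathcal{M}}$ by a crabbed path of length at most $n-r+1$. Then the Hirsch conjecture holds, i.e. the graph of every $d$-dimensional simple polytope with $f$ facets has diameter at most $f-d$.
   Context: Let $E$ be a finite ground set with $|E|=n$. A sign vector on $E$ is an element $X\in\{+,-,0\}^E$. Write $X^+=\{e\in E: X_e=+\}$, $X^-=\{e\in E: X_e=-\}$, $X^0=\{e\in E: X_e=0\}$, and $\underline{X}=E\setminus X^0$ (the support); $-X$ is $X$ with all signs reversed. The separator of $X,Y$ is $S(X,Y)=\{e\in E:\{X_e,Y_e\}=\{+,-\}\}$. $\Delta$ denotes symmetric difference. A uniform oriented matroid of rank $r$ ($1\le r\le n$) is a pair $\mathcal{M}=(E,\mathcal{C}^* )$ where $\mathcal{C}^*\subseteq\{+,-,0\}^E$ (the set of cocircuits) satisfies: (C1) Every $X\in\mathcal{C}^*$ has support of size $n-r+1$. (C2) For every $I\subseteq E$ of size $n-r+1$ there are exactly two cocircuits $X,Y$ with support $I$; moreover $Y=-X$. (C3) For all $X,Y\in\mathcal{C}^*$ with $X\neq -Y$ and every $e\in S(X,Y)$ there is $Z\in\mathcal{C}^*$ with $Z_e=0$ and $Z_f\in\{X_f,Y_f,0\}$ for every $f\in E\setminus\{e\}$. The cocircuit graph $G_{\mathcal{M}}$ has vertex set $\mathcal{C}^*$, with $X$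 and $Y$ adjacent if and only if $|X^0\,\Delta\,Y^0|=2$ and $S(X,Y)=\emptyset$. A tope of $\mathcal{M}$ is a maximal (with respect to inclusion) set $T\subseteq\mathcal{C}^*$ such that $S(X,Y)=\emptyset$ for all $X,Y\in T$. A path in $G_{\mathcal{M}}$ from $X$ to $Y$ is crabbed if every vertex $Z$ on it satisfies $Z^+\subseteq X^+\cup Y^+$ and $Z^-\subseteq X^-\cup Y^-$. The length of a path is its number of edges. *)

theory Defs
  imports
    "HOL-Analysis.Analysis"
    "HOL-Library.FuncSet"
    "HOL-Library.Extended_Nat"
    "Graph_Theory.Graph_Theory"
begin

section \<open>Sign vectors\<close>

datatype sign = Pos | Neg | Zero

fun opp :: "sign \<Rightarrow> sign" where
  "opp Pos = Neg"
| "opp Neg = Pos"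
| "opp Zero = Zero"

text \<open>Sign vectors on \<open>E\<close> are the elements of \<open>E \<rightarrow>\<^sub>E UNIV\<close>, i.e. extensional functions,
  so that equality of functions is equality of sign vectors.\<close>

type_synonym 'e signvec = "'e \<Rightarrow> sign"

definition pos_part :: "'e set \<Rightarrow> 'e signvec \<Rightarrow> 'e set" where
  "pos_part E X = {e \<in> E. X e = Pos}"

definition neg_part :: "'e set \<Rightarrow> 'e signvec \<Rightarrow> 'e set" where
  "neg_part E X = {e \<in> E. X e = Neg}"

definition zero_part :: "'e set \<Rightarrow> 'e signvec \<Rightarrow> 'e set" where
  "zero_part E X = {e \<in> E. X e = Zero}"

definition supp :: "'e set \<Rightarrow> 'e signvec \<Rightarrow> 'e set" where
  "supp E X = E - zero_part E X"

definition opposite :: "'e set \<Rightarrow> 'e signvec \<Rightarrow> 'e signvec" where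
  "opposite E X = (\<lambda>e\<in>E. opp (X e))"

definition separator :: "'e set \<Rightarrow> 'e signvec \<Rightarrow> 'e signvec \<Rightarrow> 'e set" where
  "separator E X Y = {e \<in> E. {X e, Y e} = {Pos, Neg}}"

section \<open>Uniform oriented matroids\<close>

definition uniform_oriented_matroid :: "'e set \<Rightarrow> 'e signvec set \<Rightarrow> nat \<Rightarrow> bool" where
  "uniform_oriented_matroid E C r \<longleftrightarrow>
     finite E \<and> 1 \<le> r \<and> r \<le> card E \<and>
     C \<subseteq> (E \<rightarrow>\<^sub>E UNIV) \<and>
     (\<forall>X\<in>C. card (supp E X) = card E - r + 1) \<and>
     (\<forall>I. I \<subseteq> E \<and> card I = card E - r + 1 \<longrightarrow>
        (\<exists>X Y. X \<noteq> Y \<and> {Z \<in> C. supp E Z = I} = {X, Y} \<and> Y = opposite E X)) \<and>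
     (\<forall>X\<in>C. \<forall>Y\<in>C. X \<noteq> opposite E Y \<longrightarrow>
        (\<forall>e \<in> separator E X Y.
           \<exists>Z\<in>C. Z e = Zero \<and> (\<forall>f \<in> E - {e}. Z f \<in> {X f, Y f, Zero})))"

definition conformal :: "'e set \<Rightarrow> 'e signvec set \<Rightarrow> bool" where
  "conformal E T \<longleftrightarrow> (\<forall>X\<in>T. \<forall>Y\<in>T. separator E X Y = {})"

definition tope :: "'e set \<Rightarrow> 'e signvec set \<Rightarrow> 'e signvec set \<Rightarrow> bool" where
  "tope E C T \<longleftrightarrow>
     T \<subseteq> C \<and> conformal E T \<and> (\<forall>T'. T \<subseteq> T' \<and> T' \<subseteq> C \<and> conformal E T' \<longrightarrow> T' = T)"

section \<open>Graphs\<close>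

text \<open>An undirected simple graph is represented by the digraph with both orientations of every
  edge.\<close>

definition path_between :: "'v pair_pre_digraph \<Rightarrow> 'v \<Rightarrow> 'v list \<Rightarrow> 'v \<Rightarrow> bool" where
  "path_between G u p v \<longleftrightarrow> vpath p (with_proj G) \<and> hd p = u \<and> last p = v"

definition graph_distance :: "'v pair_pre_digraph \<Rightarrow> 'v \<Rightarrow> 'v \<Rightarrow> enat" where
  "graph_distance G u v = (INF p \<in> {p. path_between G u p v}. enat (vwalk_length p))"

definition graph_diameter :: "'v pair_pre_digraph \<Rightarrow> enat" where
  "graph_diameter G = (SUP u \<in> pverts G. SUP v \<in> pverts G. graph_distance G u v)"

definition cocircuit_graph :: "'e set \<Rightarrow> 'e signvec set \<Rightarrow> 'e signvec pair_pre_digraph" where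
  "cocircuit_graph E C =
     \<lparr> pverts = C,
       parcs = {(X, Y). X \<in> C \<and> Y \<in> C \<and>
                  card (sym_diff (zero_part E X) (zero_part E Y)) = 2 \<and>
                  separator E X Y = {}} \<rparr>"

definition crabbed_path ::
    "'e set \<Rightarrow> 'e signvec set \<Rightarrow> 'e signvec \<Rightarrow> 'e signvec list \<Rightarrow> 'e signvec \<Rightarrow> bool" where
  "crabbed_path E C X p Y \<longleftrightarrow>
     path_between (cocircuit_graph E C) X p Y \<and>
     (\<forall>Z\<in>set p. pos_part E Z \<subseteq> pos_part E X \<union> pos_part E Y \<and>
                neg_part E Z \<subseteq> neg_part E X \<union> neg_part E Y)"

section \<open>Polytopes\<close>

text \<open>Dimension is affine dimension, so a polytope need not be full-dimensional in its ambient
  space.\<close>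

definition simple_polytope :: "'a::euclidean_space set \<Rightarrow> bool" where
  "simple_polytope P \<longleftrightarrow>
     polytope P \<and>
     (\<forall>x. x extreme_point_of P \<longrightarrow> int (card {F. F facet_of P \<and> x \<in> F}) = aff_dim P)"

definition polytope_graph :: "'a::euclidean_space set \<Rightarrow> 'a pair_pre_digraph" where
  "polytope_graph P =
     \<lparr> pverts = {x. x extreme_point_of P},
       parcs = {(x, y). x extreme_point_of P \<and> y extreme_point_of P \<and>
                  closed_segment x y edge_of P} \<rparr>"

end

(* Homogenising a simple d-polytope P with f facets gives f facet normals in a (d+1)-dimensional space.
   Simplicity makes every vertex of P a transversal intersection of d facet hyperplanes, so the normals
   can be moved into general position without losing any vertex. The signs of the linear functionals
   then form a uniform oriented matroid of rank d+1 on f elements, and each vertex of P becomes a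
   nonnegative cocircuit whose zero set is the set of facets through the vertex. A crabbed path between
   two such cocircuits stays nonnegative. It also stays among the vertices of P: if d-1 of the facets at
   a vertex are kept, the edge of P already supplies a second nonnegative cocircuit vanishing on them,
   and a pointed two-dimensional cone has no third extreme ray. *)

theory Submission
  imports Defs
begin

section \<open>Perturbing vectors into general position\<close>

text \<open>General position has to be created: in a 3-cube the four normals of two pairs of
  opposite facets, homogenised to dimension 4, are linearly dependent, whereas uniformity of rank
  d+1 asks any d+1 normals to be independent. The perturbation is only shown to preserve each single
  vertex, not the combinatorial type of P, so nonnegative cocircuits that belong to no vertex are
  not excluded beforehand. For this reason a path is lifted edge by edge from a vertex where it
  starts, and a step uses only the tight sets, a positive ray over each vertex and the edges of P.
  The bound f - d is n - r + 1 with n = f and r = d + 1. For a polytope that is not full-dimensional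
  this rank is obtained by taking all normals in \<open>L \<times> UNIV\<close>, where
  \<open>L\<close> is the direction space of the affine hull.\<close>

lemma eventually_line_notin_subspace:
  fixes v w :: "'b::real_vector"
  assumes U: "subspace U" and vw: "v \<notin> U \<or> w \<notin> U"
  shows "eventually (\<lambda>t. v + t *\<^sub>R w \<notin> U) (at_right (0::real))"
proof (cases "\<exists>t0>0. v + t0 *\<^sub>R w \<in> U")
  case True
  then obtain t0 where t0: "t0 > 0" "v + t0 *\<^sub>R w \<in> U" by blast
  \<comment> \<open>Two points of the line in \<open>U\<close> would put \<open>w\<close>, and then
    \<open>v\<close>, into \<open>U\<close>; so the line meets \<open>U\<close> at most
    once.\<close>
  have "v + t *\<^sub>R w \<notin> U" if "0 < t" "t < t0" for t
  proof
    assume t: "v + t *\<^sub>R w \<in> U"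
    have "(v + t0 *\<^sub>R w) - (v + t *\<^sub>R w) \<in> U" using U t0 t by (intro subspace_diff)
    then have "(t0 - t) *\<^sub>R w \<in> U" by (simp add: algebra_simps)
    from subspace_scale[OF U this, of "inverse (t0 - t)"] have w: "w \<in> U" using that by simp
    have "(v + t *\<^sub>R w) - t *\<^sub>R w \<in> U" using U t w by (intro subspace_diff subspace_scale)
    then show False using vw w by simp
  qed
  then show ?thesis unfolding eventually_at_right_field using t0(1) by blast
next
  case False
  then show ?thesis unfolding eventually_at_right_field by (intro exI[of _ 1]) auto
qed

text \<open>A real vector space is not a finite union of proper subspaces. A point that avoids the
  earlier subspaces keeps avoiding them under a small move, and moving it in a direction outside
  \<open>U\<close> also leaves \<open>U\<close>.\<close>

lemma exists_notin_finite_subspaces: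
  fixes S :: "'b::real_vector set"
  assumes "finite \<U>" "subspace S"
    and "\<And>U. U \<in> \<U> \<Longrightarrow> subspace U" "\<And>U. U \<in> \<U> \<Longrightarrow> \<not> S \<subseteq> U"
  shows "\<exists>w\<in>S. \<forall>U\<in>\<U>. w \<notin> U"
  using assms
proof (induction \<U> rule: finite_induct)
  case empty
  then show ?case using subspace_0 by auto
next
  case (insert U \<U>)
  then obtain w where w: "w \<in> S" "\<forall>U\<in>\<U>. w \<notin> U" by auto
  obtain u where u: "u \<in> S" "u \<notin> U" using insert.prems(3)[of U] by auto
  have "eventually (\<lambda>t. \<forall>U'\<in>insert U \<U>. w + t *\<^sub>R u \<notin> U') (at_right (0::real))"
    using insert.hyps insert.prems w u
    by (intro eventually_ball_finite) (auto intro!: eventually_line_notin_subspace)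
  then obtain t where t: "\<forall>U'\<in>insert U \<U>. w + t *\<^sub>R u \<notin> U'"
    using eventually_happens trivial_limit_at_right_real by blast
  moreover have "w + t *\<^sub>R u \<in> S" using w u insert.prems(1) by (intro subspace_add subspace_scale)
  ultimately show ?case by blast
qed

text \<open>Injectivity is part of the notion because the image set alone would hide repeated
  vectors.\<close>

definition indep_family :: "('i \<Rightarrow> 'b::real_vector) \<Rightarrow> 'i set \<Rightarrow> bool" where
  "indep_family v I \<longleftrightarrow> inj_on v I \<and> independent (v ` I)"

lemma indep_family_cong:
  assumes "\<And>i. i \<in> I \<Longrightarrow> v i = w i"
  shows "indep_family v I \<longleftrightarrow> indep_family w I"
  unfolding indep_family_def using assms by (metis image_cong inj_on_cong)

lemma indep_family_subset: "indep_family v I \<Longrightarrow> J \<subseteq> I \<Longrightarrow> indep_family v J"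
  unfolding indep_family_def by (meson image_mono independent_mono inj_on_subset)

lemma indep_family_insert:
  assumes "k \<notin> I"
  shows "indep_family v (insert k I) \<longleftrightarrow> indep_family v I \<and> v k \<notin> span (v ` I)"
  using assms unfolding indep_family_def
  by (auto simp: independent_insert span_base image_iff split: if_splits)

lemma dim_span_indep_family:
  fixes v :: "'i \<Rightarrow> 'b::euclidean_space"
  assumes "indep_family v I"
  shows "dim (span (v ` I)) = card I"
  using assms unfolding indep_family_def by (simp add: card_image dim_eq_card_independent)

lemma inner_eq_0_span:
  fixes y :: "'b::real_inner"
  assumes "\<And>x. x \<in> A \<Longrightarrow> x \<bullet> y = 0" "z \<in> span A"
  shows "z \<bullet> y = 0"
proof -
  have "orthogonal y z"
    by (rule orthogonal_to_span[OF assms(2)]) (simp add: orthogonal_def assms(1) inner_commute)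
  then show ?thesis by (simp add: orthogonal_def inner_commute)
qed

text \<open>The component of \<open>v k\<close> orthogonal to the other vectors is nonzero by
  independence; rescaled, it is the required dual vector. It stays in \<open>S\<close> because the
  part subtracted from \<open>v k\<close> lies in a span of vectors of \<open>S\<close>.\<close>

lemma dual_vector_exists:
  fixes v :: "'i \<Rightarrow> 'b::euclidean_space"
  assumes S: "subspace S" and vS: "v ` I \<subseteq> S" and ind: "indep_family v I" and k: "k \<in> I"
  shows "\<exists>u\<in>S. v k \<bullet> u = 1 \<and> (\<forall>i\<in>I - {k}. v i \<bullet> u = 0)"
proof -
  let ?A = "v ` (I - {k})"
  have nk: "v k \<notin> span ?A"
    using indep_family_insert[of k "I - {k}" v] ind k by (simp add: insert_absorb)
  obtain p q where p: "p \<in> span ?A" and q: "\<And>w. w \<in> span ?A \<Longrightarrow> orthogonal q w" and pq: "v k = p + q"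
    using orthogonal_subspace_decomp_exists by metis
  have q0: "q \<noteq> 0" using nk p pq by auto
  have "span ?A \<subseteq> S" by (rule span_minimal) (use vS S in auto)
  then have "p \<in> S" using p by blast
  then have qS: "q \<in> S" using pq vS k S subspace_diff[OF S, of "v k" p] by auto
  have vq: "v k \<bullet> q = q \<bullet> q"
    using q[OF p] unfolding pq by (simp add: inner_left_distrib orthogonal_def inner_commute[of p])
  have "v i \<bullet> q = 0" if "i \<in> I - {k}" for i
    using q[of "v i"] that by (simp add: span_base orthogonal_def inner_commute)
  then show ?thesis
    using q0 qS S vq by (intro bexI[of _ "(1 / (q \<bullet> q)) *\<^sub>R q"]) (auto simp: subspace_scale)
qed

text \<open>\<open>I\<close> is the set of tight constraints at a nondegenerate vertex of the cone
  \<open>{y \<in> S. \<forall>i\<in>E. 0 \<le> v i \<bullet> y}\<close>; the ray \<open>y\<close> represents the vertex.\<close>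

definition cuts_vertex :: "'b::real_inner set \<Rightarrow> 'i set \<Rightarrow> ('i \<Rightarrow> 'b) \<Rightarrow> 'i set \<Rightarrow> bool" where
  "cuts_vertex S E v I \<longleftrightarrow>
     indep_family v I \<and> (\<exists>y\<in>S. (\<forall>i\<in>I. v i \<bullet> y = 0) \<and> (\<forall>i\<in>E - I. 0 < v i \<bullet> y))"

text \<open>Being a nondegenerate vertex is an open condition. If \<open>k\<close> is not tight, the
  old ray still works; if \<open>k\<close> is tight, the ray is corrected along the vector dual to
  \<open>v k\<close>, and the finitely many strict inequalities survive by continuity.\<close>

lemma cuts_vertex_perturb:
  fixes v :: "'i \<Rightarrow> 'b::euclidean_space"
  assumes S: "subspace S" and E: "finite E" "k \<in> E" "I \<subseteq> E" and vS: "v ` E \<subseteq> S"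
    and cut: "cuts_vertex S E v I"
  shows "eventually (\<lambda>t. cuts_vertex S E (v(k := v k + t *\<^sub>R w)) I) (at_right 0)"
proof -
  obtain y where y: "y \<in> S" "\<And>i. i \<in> I \<Longrightarrow> v i \<bullet> y = 0" "\<And>i. i \<in> E \<Longrightarrow> i \<notin> I \<Longrightarrow> 0 < v i \<bullet> y"
    and ind: "indep_family v I"
    using cut unfolding cuts_vertex_def by auto
  show ?thesis
  proof (cases "k \<in> I")
    case False
    have "((\<lambda>t. (v k + t *\<^sub>R w) \<bullet> y) \<longlongrightarrow> (v k + 0 *\<^sub>R w) \<bullet> y) (at_right 0)"
      by (intro tendsto_intros)
    then have "eventually (\<lambda>t. 0 < (v k + t *\<^sub>R w) \<bullet> y) (at_right 0)"
      using y(3)[OF E(2) False] by (intro order_tendstoD(1)) auto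
    then show ?thesis
    proof eventually_elim
      case (elim t)
      have "indep_family (v(k := v k + t *\<^sub>R w)) I"
        using ind False by (subst indep_family_cong[of I _ v]) auto
      then show ?case unfolding cuts_vertex_def using y elim False by (auto intro!: bexI[of _ y])
    qed
  next
    case True
    obtain u where u: "u \<in> S" "v k \<bullet> u = 1" "\<And>i. i \<in> I - {k} \<Longrightarrow> v i \<bullet> u = 0"
      using dual_vector_exists[OF S _ ind True] vS E(3) by blast
    \<comment> \<open>\<open>s t\<close> solves \<open>(v k + t w) \<bullet> (y + s u) = 0\<close>; since \<open>u\<close> is orthogonal to the other
      vectors indexed by \<open>I\<close>, the ray \<open>y + s t u\<close> stays on all hyperplanes of \<open>I\<close>.\<close>
    define s where "s t = - (t * (w \<bullet> y)) / (1 + t * (w \<bullet> u))" for t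
    have "((\<lambda>t. 1 + t * (w \<bullet> u)) \<longlongrightarrow> 1 + 0 * (w \<bullet> u)) (at_right 0)"
      by (intro tendsto_intros)
    then have ev1: "eventually (\<lambda>t. 0 < 1 + t * (w \<bullet> u)) (at_right 0)"
      by (intro order_tendstoD(1)) auto
    have "(s \<longlongrightarrow> - (0 * (w \<bullet> y)) / (1 + 0 * (w \<bullet> u))) (at_right 0)"
      unfolding s_def by (intro tendsto_intros) auto
    then have s0: "(s \<longlongrightarrow> 0) (at_right 0)" by simp
    have "eventually (\<lambda>t. 0 < v j \<bullet> (y + s t *\<^sub>R u)) (at_right 0)" if "j \<in> E - I" for j
    proof -
      have "((\<lambda>t. v j \<bullet> (y + s t *\<^sub>R u)) \<longlongrightarrow> v j \<bullet> (y + 0 *\<^sub>R u)) (at_right 0)"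
        by (intro tendsto_intros s0)
      then show ?thesis using y(3)[of j] that by (intro order_tendstoD(1)) auto
    qed
    then have "eventually (\<lambda>t. \<forall>j\<in>E - I. 0 < v j \<bullet> (y + s t *\<^sub>R u)) (at_right 0)"
      using E(1) by (intro eventually_ball_finite) auto
    with ev1 show ?thesis
    proof eventually_elim
      case (elim t)
      let ?v = "v(k := v k + t *\<^sub>R w)"
      have im: "?v ` (I - {k}) = v ` (I - {k})" by auto
      \<comment> \<open>The dual vector \<open>u\<close> certifies independence: it is orthogonal to
        the other vectors, but its product with the new one is
        \<open>1 + t * (w \<bullet> u)\<close>, which is positive.\<close>
      have "?v k \<notin> span (v ` (I - {k}))"
      proof
        assume "?v k \<in> span (v ` (I - {k}))"
        then have "?v k \<bullet> u = 0" by (rule inner_eq_0_span[rotated]) (use u in auto)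
        then show False using elim u by (simp add: inner_left_distrib)
      qed
      moreover have "indep_family ?v (I - {k})"
        using indep_family_subset[OF ind, of "I - {k}"] indep_family_cong[of "I - {k}" v ?v] by auto
      ultimately have "indep_family ?v (insert k (I - {k}))"
        by (subst indep_family_insert) (auto simp: im)
      then have "indep_family ?v I" using True by (simp add: insert_absorb)
      moreover have "?v k \<bullet> (y + s t *\<^sub>R u) = 0"
        using elim(1) y(2)[OF True] u(2) unfolding s_def by (simp add: algebra_simps divide_simps)
      then have "?v i \<bullet> (y + s t *\<^sub>R u) = 0" if "i \<in> I" for i
        using y(2)[OF that] u(3)[of i] that by (cases "i = k") (auto simp: inner_right_distrib)
      moreover have "0 < ?v i \<bullet> (y + s t *\<^sub>R u)" if "i \<in> E - I" for i
        using elim(2) that True by auto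
      moreover have "y + s t *\<^sub>R u \<in> S" using y u S by (intro subspace_add subspace_scale)
      ultimately show ?case unfolding cuts_vertex_def by blast
    qed
  qed
qed

text \<open>The vectors are moved one at a time, each so little that every prescribed vertex
  survives. The new position of \<open>v k\<close> only has to avoid the spans of fewer than
  \<open>dim S\<close> vectors already treated; these are finitely many proper subspaces.\<close>

lemma generic_perturbation:
  fixes v :: "'i \<Rightarrow> 'b::euclidean_space"
  assumes S: "subspace S" and E: "finite E" and vS: "v ` E \<subseteq> S"
    and \<I>: "finite \<I>" "\<And>I. I \<in> \<I> \<Longrightarrow> I \<subseteq> E" "\<And>I. I \<in> \<I> \<Longrightarrow> cuts_vertex S E v I"
  shows "\<exists>v'. v' ` E \<subseteq> S \<and> (\<forall>I\<in>\<I>. cuts_vertex S E v' I) \<and>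
           (\<forall>J\<subseteq>E. card J \<le> dim S \<longrightarrow> indep_family v' J)"
proof -
  have "\<exists>v'. v' ` E \<subseteq> S \<and> (\<forall>I\<in>\<I>. cuts_vertex S E v' I) \<and>
           (\<forall>J\<subseteq>K. card J \<le> dim S \<longrightarrow> indep_family v' J)" if "finite K" "K \<subseteq> E" for K
    using that
  proof (induction K rule: finite_induct)
    case empty
    then show ?case using vS \<I>(3) by (intro exI[of _ v]) (auto simp: indep_family_def independent_empty)
  next
    case (insert k K)
    then obtain x where x: "x ` E \<subseteq> S" "\<And>I. I \<in> \<I> \<Longrightarrow> cuts_vertex S E x I"
      and gen: "\<And>J. J \<subseteq> K \<Longrightarrow> card J \<le> dim S \<Longrightarrow> indep_family x J" by auto
    define \<U> where "\<U> = (\<lambda>J. span (x ` J)) ` {J. J \<subseteq> K \<and> card J < dim S}"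
    have fin: "finite \<U>" unfolding \<U>_def using insert.hyps by auto
    have notS: "\<not> S \<subseteq> U" if U: "U \<in> \<U>" for U
    proof
      assume "S \<subseteq> U"
      obtain J where J: "J \<subseteq> K" "card J < dim S" "U = span (x ` J)" using U \<U>_def by auto
      then have "dim U = card J" using gen[of J] by (simp only: dim_span_indep_family less_imp_le)
      then show False using dim_subset[OF \<open>S \<subseteq> U\<close>] J(2) by simp
    qed
    obtain w where w: "w \<in> S" "\<forall>U\<in>\<U>. w \<notin> U"
      using exists_notin_finite_subspaces[OF fin S] notS unfolding \<U>_def by blast
    \<comment> \<open>\<open>x k\<close> may lie in some of the spans, but \<open>w\<close> lies in
      none, which is enough for all small positive \<open>t\<close>.\<close>
    have "eventually (\<lambda>t. \<forall>U\<in>\<U>. x k + t *\<^sub>R w \<notin> U) (at_right 0)"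
      using fin w by (intro eventually_ball_finite ballI eventually_line_notin_subspace)
        (auto simp: \<U>_def)
    moreover have "eventually (\<lambda>t. \<forall>I\<in>\<I>. cuts_vertex S E (x(k := x k + t *\<^sub>R w)) I) (at_right 0)"
      using insert.prems x \<I> by (intro eventually_ball_finite ballI cuts_vertex_perturb S E) auto
    ultimately obtain t where t: "\<forall>U\<in>\<U>. x k + t *\<^sub>R w \<notin> U"
      "\<forall>I\<in>\<I>. cuts_vertex S E (x(k := x k + t *\<^sub>R w)) I"
      using eventually_happens[OF eventually_conj] trivial_limit_at_right_real by blast
    let ?x = "x(k := x k + t *\<^sub>R w)"
    have "indep_family ?x J" if J: "J \<subseteq> insert k K" "card J \<le> dim S" for J
    proof -
      have fJ: "finite J" using J insert.hyps finite_subset by blast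
      have J': "J - {k} \<subseteq> K" "card (J - {k}) \<le> dim S"
        using J card_Diff1_le[of J k] by auto
      have "indep_family ?x (J - {k})"
        using gen[OF J'] indep_family_cong[of "J - {k}" x ?x] by auto
      moreover have "?x k \<notin> span (?x ` (J - {k}))" if "k \<in> J"
      proof -
        have "?x ` (J - {k}) = x ` (J - {k})" by auto
        moreover have "card (J - {k}) < dim S" using J(2) that fJ card_Diff1_less[of J k] by linarith
        ultimately show ?thesis using t(1) J' unfolding \<U>_def by auto
      qed
      ultimately show ?thesis
        using indep_family_insert[of k "J - {k}" ?x] by (cases "k \<in> J") (auto simp: insert_absorb)
    qed
    moreover have "?x ` E \<subseteq> S" using x(1) w(1) S insert.prems by (auto intro!: subspace_add subspace_scale)
    ultimately show ?case using t(2) by blast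
  qed
  from this[OF E order_refl] show ?thesis .
qed

section \<open>Oriented matroids of vectors in general position\<close>

locale generic_vectors =
  fixes S :: "'b::euclidean_space set" and E :: "'i set" and v :: "'i \<Rightarrow> 'b"
  assumes subspace_S: "subspace S" and finite_E: "finite E" and v_in_S: "v ` E \<subseteq> S"
    and generic: "\<And>J. J \<subseteq> E \<Longrightarrow> card J \<le> dim S \<Longrightarrow> indep_family v J"
    and dim_pos: "1 \<le> dim S" and dim_le_card: "dim S \<le> card E"
begin

definition zeros :: "'b \<Rightarrow> 'i set" where
  "zeros y = {e \<in> E. v e \<bullet> y = 0}"

definition sign_of :: "'b \<Rightarrow> 'i signvec" where
  "sign_of y = (\<lambda>e\<in>E. if 0 < v e \<bullet> y then Pos else if v e \<bullet> y < 0 then Neg else Zero)"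

text \<open>These are the signs of the rays of a hyperplane arrangement in \<open>S\<close>: in
  general position a nonzero vector of \<open>S\<close> has at most \<open>dim S - 1\<close>
  zeros.\<close>

definition cocircuits :: "'i signvec set" where
  "cocircuits = sign_of ` {y \<in> S. y \<noteq> 0 \<and> card (zeros y) = dim S - 1}"

lemma zeros_subset: "zeros y \<subseteq> E" and finite_zeros: "finite (zeros y)"
  unfolding zeros_def using finite_E by auto

lemma zero_part_sign_of [simp]: "zero_part E (sign_of y) = zeros y"
  unfolding zero_part_def sign_of_def zeros_def by auto

lemma supp_sign_of [simp]: "supp E (sign_of y) = E - zeros y"
  unfolding supp_def by simp

lemma opposite_sign_of: "opposite E (sign_of y) = sign_of (- y)"
  unfolding opposite_def sign_of_def by (auto simp: fun_eq_iff)

lemma sign_of_scale_pos: "c > 0 \<Longrightarrow> sign_of (c *\<^sub>R y) = sign_of y"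
  unfolding sign_of_def by (auto simp: fun_eq_iff zero_less_mult_iff mult_less_0_iff)

lemma finite_cocircuits: "finite cocircuits"
proof (rule finite_subset)
  show "cocircuits \<subseteq> E \<rightarrow>\<^sub>E {Pos, Neg, Zero}"
    unfolding cocircuits_def sign_of_def by (auto split: if_splits)
  show "finite (E \<rightarrow>\<^sub>E {Pos, Neg, Zero})" using finite_E by (intro finite_PiE) auto
qed

text \<open>Any \<open>dim S\<close> of the vectors span \<open>S\<close>, so a vector of
  \<open>S\<close> orthogonal to all of them is orthogonal to itself.\<close>

lemma card_zeros_less:
  assumes "y \<in> S" "y \<noteq> 0"
  shows "card (zeros y) < dim S"
proof (rule ccontr)
  assume "\<not> card (zeros y) < dim S"
  then obtain J where J: "J \<subseteq> zeros y" "card J = dim S"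
    by (meson linorder_not_less obtain_subset_with_card_n)
  have JE: "J \<subseteq> E" using J zeros_subset by blast
  have "span (v ` J) \<subseteq> S" using JE v_in_S subspace_S by (intro span_minimal) auto
  moreover have "dim (span (v ` J)) = dim S"
    using dim_span_indep_family[OF generic[OF JE]] J by simp
  ultimately have "span (v ` J) = S"
    using subspace_dim_equal[OF subspace_span subspace_S] by auto
  then have "y \<in> span (v ` J)" using assms by simp
  then have "y \<bullet> y = 0" by (rule inner_eq_0_span[rotated]) (use J zeros_def in auto)
  then show False using assms by simp
qed

lemma exists_orthogonal:
  assumes "I \<subseteq> E" "card I < dim S"
  shows "\<exists>y\<in>S. y \<noteq> 0 \<and> I \<subseteq> zeros y"
proof -
  have "dim (v ` I) < dim S"
    using dim_span_indep_family[OF generic, of I] assms by simp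
  moreover have "span (v ` I) \<subseteq> S" using assms v_in_S subspace_S by (intro span_minimal) auto
  ultimately have "span (v ` I) \<subset> span S"
    using subspace_S by (metis dim_span order_less_irrefl psubsetI span_eq_iff)
  then obtain y where "y \<noteq> 0" "y \<in> span S" and y: "\<And>x. x \<in> span (v ` I) \<Longrightarrow> orthogonal y x"
    using orthogonal_to_subspace_exists_gen by metis
  moreover have "I \<subseteq> zeros y"
    using y assms by (auto simp: zeros_def orthogonal_def span_base inner_commute[of _ y])
  ultimately show ?thesis using subspace_S by (metis span_eq_iff)
qed

lemma proportional:
  assumes I: "I \<subseteq> E" "card I = dim S - 1"
    and y: "y \<in> S" "y \<noteq> 0" "I \<subseteq> zeros y" and z: "z \<in> S" "z \<noteq> 0" "I \<subseteq> zeros z"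
  shows "\<exists>c. c \<noteq> 0 \<and> z = c *\<^sub>R y"
proof -
  have "card I < card E" using I dim_pos dim_le_card by linarith
  then obtain e where e: "e \<in> E" "e \<notin> I" using I(1) by (metis card_mono finite_subset finite_E leD subsetI)
  have fI: "finite I" using I(1) finite_E finite_subset by blast
  have c: "card (insert e I) = dim S" using e fI I(2) dim_pos by simp
  have ne: "v e \<bullet> x \<noteq> 0" if "x \<in> S" "x \<noteq> 0" "I \<subseteq> zeros x" for x
  proof
    assume "v e \<bullet> x = 0"
    then have "insert e I \<subseteq> zeros x" using that e by (auto simp: zeros_def)
    then have "dim S \<le> card (zeros x)" using c finite_zeros by (metis card_mono)
    then show False using card_zeros_less[of x] that by simp
  qed
  \<comment> \<open>This ratio makes \<open>z - k *\<^sub>R y\<close> vanish at \<open>e\<close> as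
    well as on \<open>I\<close>. That is \<open>dim S\<close> zeros, too many for a nonzero
    vector.\<close>
  define k where "k = (v e \<bullet> z) / (v e \<bullet> y)"
  have k: "k \<noteq> 0" unfolding k_def using ne y z by simp
  have "z - k *\<^sub>R y = 0"
  proof (rule ccontr)
    assume "z - k *\<^sub>R y \<noteq> 0"
    moreover have "z - k *\<^sub>R y \<in> S" using y z subspace_S by (intro subspace_diff subspace_scale)
    moreover have "I \<subseteq> zeros (z - k *\<^sub>R y)"
      using y(3) z(3) unfolding zeros_def by (simp add: subset_iff inner_diff_right)
    ultimately have "v e \<bullet> (z - k *\<^sub>R y) \<noteq> 0" by (intro ne)
    then show False using ne[OF y] by (simp add: k_def inner_diff_right)
  qed
  then show ?thesis using k by auto
qed

text \<open>Among the nonzero vectors whose signs agree with those of \<open>z\<close> wherever they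
  are nonzero, one with the most zeros is taken. Were it not a cocircuit, it could be moved, keeping
  its zeros, until a further coordinate vanishes for the first time.\<close>

lemma conformal_cocircuit_exists:
  assumes z: "z \<in> S" "z \<noteq> 0"
  shows "\<exists>y\<in>S. y \<noteq> 0 \<and> card (zeros y) = dim S - 1 \<and>
           (\<forall>e\<in>E. v e \<bullet> y = 0 \<or> sgn (v e \<bullet> y) = sgn (v e \<bullet> z))"
proof -
  define Q where "Q y \<longleftrightarrow> y \<in> S \<and> y \<noteq> 0 \<and> (\<forall>e\<in>E. v e \<bullet> y = 0 \<or> sgn (v e \<bullet> y) = sgn (v e \<bullet> z))" for y
  have "Q z" unfolding Q_def using z by simp
  then have "\<exists>y. Q y \<and> (\<forall>y'. Q y' \<longrightarrow> card (zeros y') \<le> card (zeros y))"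
    by (rule ex_has_greatest_nat[of Q z _ "dim S"]) (use card_zeros_less Q_def in \<open>auto intro: less_imp_le\<close>)
  then obtain y where Qy: "Q y" and max: "\<And>y'. Q y' \<Longrightarrow> card (zeros y') \<le> card (zeros y)"
    by blast
  have y: "y \<in> S" "y \<noteq> 0" and ysgn: "\<And>e. e \<in> E \<Longrightarrow> v e \<bullet> y = 0 \<or> sgn (v e \<bullet> y) = sgn (v e \<bullet> z)"
    using Qy unfolding Q_def by auto
  have "card (zeros y) = dim S - 1"
  proof (rule ccontr)
    assume "card (zeros y) \<noteq> dim S - 1"
    then have less: "card (zeros y) + 1 < dim S" using card_zeros_less[OF y] by linarith
    then have "zeros y \<noteq> E" using dim_le_card by auto
    then obtain e where e: "e \<in> E" "e \<notin> zeros y" using zeros_subset by blast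
    \<comment> \<open>Making \<open>u0\<close> vanish at the extra index \<open>e\<close> keeps the
      later \<open>y'\<close> away from 0: its value at \<open>e\<close> will be
      \<open>m * (v e \<bullet> y)\<close>.\<close>
    have "card (insert e (zeros y)) < dim S" using less e finite_zeros by simp
    then obtain u0 where u0: "u0 \<in> S" "u0 \<noteq> 0" "insert e (zeros y) \<subseteq> zeros u0"
      using exists_orthogonal[of "insert e (zeros y)"] e zeros_subset by blast
    have "zeros u0 \<noteq> E" using card_zeros_less[OF u0(1,2)] dim_le_card by auto
    then obtain g where g: "g \<in> E" "g \<notin> zeros u0" using zeros_subset by blast
    then have g': "g \<in> E - zeros y" using u0 by auto
    \<comment> \<open>The sign factor makes the ratio at \<open>g\<close> positive, hence also the
      maximum \<open>m\<close>.\<close>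
    define u where "u = sgn ((v g \<bullet> u0) / (v g \<bullet> y)) *\<^sub>R u0"
    have u: "u \<in> S" "insert e (zeros y) \<subseteq> zeros u"
      unfolding u_def using u0 subspace_S by (auto simp: zeros_def intro!: subspace_scale)
    define \<rho> where "\<rho> i = (v i \<bullet> u) / (v i \<bullet> y)" for i
    have "\<rho> g = \<bar>(v g \<bullet> u0) / (v g \<bullet> y)\<bar>"
      unfolding \<rho>_def u_def using abs_sgn[of "(v g \<bullet> u0) / (v g \<bullet> y)"] by (simp add: mult.commute)
    then have \<rho>g: "\<rho> g > 0" using g g' by (simp add: zeros_def)
    define m where "m = Max (\<rho> ` (E - zeros y))"
    have fin: "finite (\<rho> ` (E - zeros y))" using finite_E by simp
    have m: "\<rho> i \<le> m" if "i \<in> E - zeros y" for i unfolding m_def using fin that by simp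
    have "m \<in> \<rho> ` (E - zeros y)" unfolding m_def using fin g' by (intro Max_in) auto
    then obtain h where h: "h \<in> E - zeros y" "m = \<rho> h" by blast
    have mpos: "m > 0" using m[OF g'] \<rho>g by linarith
    \<comment> \<open>Every coordinate of \<open>y'\<close> is the one of \<open>y\<close> times \<open>m - \<rho> i \<ge> 0\<close>: no sign changes, and
      the coordinate attaining the maximum vanishes.\<close>
    define y' where "y' = m *\<^sub>R y - u"
    have val: "v i \<bullet> y' = (m - \<rho> i) * (v i \<bullet> y)" if "i \<in> E - zeros y" for i
      using that unfolding y'_def \<rho>_def by (simp add: zeros_def inner_diff_right algebra_simps)
    have val0: "v i \<bullet> y' = 0" if "i \<in> zeros y" for i
      using that u unfolding y'_def by (auto simp: zeros_def inner_diff_right)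
    have "\<rho> e = 0" using u unfolding \<rho>_def zeros_def by auto
    then have "v e \<bullet> y' \<noteq> 0" using val[of e] e mpos by (auto simp: zeros_def)
    then have "y' \<noteq> 0" by auto
    moreover have "y' \<in> S" unfolding y'_def using y u subspace_S by (intro subspace_diff subspace_scale)
    moreover have "v i \<bullet> y' = 0 \<or> sgn (v i \<bullet> y') = sgn (v i \<bullet> z)" if i: "i \<in> E" for i
    proof (cases "i \<in> zeros y \<or> \<rho> i = m")
      case True
      then show ?thesis using val0 val i by force
    next
      case False
      then have "\<rho> i < m" using m[of i] i by force
      then have "sgn (v i \<bullet> y') = sgn (v i \<bullet> y)" using val[of i] i False by (simp add: sgn_mult)
      then show ?thesis using ysgn[OF i] False i by (auto simp: zeros_def)
    qed
    ultimately have "Q y'" unfolding Q_def by blast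
    then have "card (zeros y') \<le> card (zeros y)" by (rule max)
    moreover have "insert h (zeros y) \<subseteq> zeros y'"
      using val0 val[OF h(1)] h zeros_subset by (auto simp: zeros_def)
    then have "card (insert h (zeros y)) \<le> card (zeros y')" by (rule card_mono[OF finite_zeros])
    ultimately show False using h finite_zeros by simp
  qed
  then show ?thesis using y ysgn by blast
qed

text \<open>In (C2), the vectors vanishing on the complement of \<open>I\<close> form a line, whose
  two rays give the opposite cocircuits. In (C3), a positive combination of the two vectors vanishes
  at \<open>e\<close>; it may have too few zeros, so a cocircuit conforming to it takes its
  place.\<close>

theorem uniform_oriented_matroid_cocircuits: "uniform_oriented_matroid E cocircuits (dim S)"
  unfolding uniform_oriented_matroid_def
proof (intro conjI ballI allI impI)
  show "finite E" "1 \<le> dim S" "dim S \<le> card E" by (fact finite_E dim_pos dim_le_card)+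
  show "cocircuits \<subseteq> E \<rightarrow>\<^sub>E UNIV" unfolding cocircuits_def sign_of_def by auto
  show "card (supp E X) = card E - dim S + 1" if "X \<in> cocircuits" for X
    using that dim_pos dim_le_card card_Diff_subset[OF finite_zeros zeros_subset]
    unfolding cocircuits_def by auto
next
  fix I assume I: "I \<subseteq> E \<and> card I = card E - dim S + 1"
  define J where "J = E - I"
  have J: "J \<subseteq> E" "card J = dim S - 1"
    using I finite_E dim_pos dim_le_card card_Diff_subset[of I E] finite_subset[of I E]
    unfolding J_def by auto
  have IJ: "I = E - J" using I J_def by auto
  obtain y where y: "y \<in> S" "y \<noteq> 0" "J \<subseteq> zeros y" using exists_orthogonal[of J] J dim_pos by auto
  have zeros_eq: "zeros z = J" if "z \<in> S" "z \<noteq> 0" "J \<subseteq> zeros z" for z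
    using card_subset_eq[OF finite_zeros that(3)] card_mono[OF finite_zeros that(3)]
      card_zeros_less[OF that(1,2)] J dim_pos by simp
  have "{Z \<in> cocircuits. supp E Z = I} = {sign_of y, opposite E (sign_of y)}"
  proof (intro equalityI subsetI)
    fix Z assume "Z \<in> {Z \<in> cocircuits. supp E Z = I}"
    then obtain z where z: "z \<in> S" "z \<noteq> 0" "Z = sign_of z" "E - zeros z = E - J"
      unfolding cocircuits_def IJ by auto
    then have "zeros z = J" using J(1) zeros_subset by blast
    then obtain c where c: "c \<noteq> 0" "z = c *\<^sub>R y" using proportional[OF J y z(1,2)] by auto
    show "Z \<in> {sign_of y, opposite E (sign_of y)}"
    proof (cases "c > 0")
      case True
      then show ?thesis using c z sign_of_scale_pos by simp
    next
      case False
      then have "sign_of z = sign_of (- y)" using sign_of_scale_pos[of "- c" "- y"] c by simp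
      then show ?thesis using z opposite_sign_of by simp
    qed
  next
    fix Z assume "Z \<in> {sign_of y, opposite E (sign_of y)}"
    moreover have "zeros (- y) = zeros y" by (simp add: zeros_def)
    ultimately show "Z \<in> {Z \<in> cocircuits. supp E Z = I}"
      using y zeros_eq[OF y] J subspace_S IJ unfolding cocircuits_def opposite_sign_of
      by (auto intro!: imageI subspace_neg)
  qed
  moreover have "sign_of y \<noteq> opposite E (sign_of y)"
  proof
    assume eq: "sign_of y = opposite E (sign_of y)"
    have "J \<noteq> E" using J dim_pos dim_le_card by auto
    then obtain e where "e \<in> E" "e \<notin> J" using J by blast
    then have "v e \<bullet> y \<noteq> 0" using zeros_eq[OF y] by (auto simp: zeros_def)
    moreover have "sign_of y e = sign_of (- y) e" using eq opposite_sign_of by simp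
    ultimately show False using \<open>e \<in> E\<close> by (auto simp: sign_of_def split: if_splits)
  qed
  ultimately show "\<exists>X Y. X \<noteq> Y \<and> {Z \<in> cocircuits. supp E Z = I} = {X, Y} \<and> Y = opposite E X"
    by blast
next
  fix X Y e assume XY: "X \<in> cocircuits" "Y \<in> cocircuits" "X \<noteq> opposite E Y" and e: "e \<in> separator E X Y"
  obtain x where x: "x \<in> S" "x \<noteq> 0" "X = sign_of x" using XY unfolding cocircuits_def by auto
  obtain y where y: "y \<in> S" "y \<noteq> 0" "Y = sign_of y" using XY unfolding cocircuits_def by auto
  have eE: "e \<in> E" and opp: "(v e \<bullet> x) * (v e \<bullet> y) < 0"
    using e unfolding separator_def x y sign_of_def
    by (auto simp: doubleton_eq_iff mult_less_0_iff split: if_splits)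
  \<comment> \<open>The values of \<open>x\<close> and \<open>y\<close> at \<open>e\<close> have
    opposite signs, so weighting each vector by the absolute value of the other one cancels
    them.\<close>
  define a b where "a = \<bar>v e \<bullet> y\<bar>" and "b = \<bar>v e \<bullet> x\<bar>"
  have ab: "a > 0" "b > 0" using opp unfolding a_def b_def by auto
  define z where "z = a *\<^sub>R x + b *\<^sub>R y"
  have ze: "v e \<bullet> z = 0"
    using opp unfolding z_def a_def b_def by (auto simp: inner_add_right abs_if mult_less_0_iff)
  \<comment> \<open>Here the exclusion of opposite cocircuits enters: \<open>z = 0\<close> would
    make \<open>x\<close> a positive multiple of \<open>- y\<close>.\<close>
  have "z \<noteq> 0"
  proof
    assume "z = 0"
    then have "a *\<^sub>R x = b *\<^sub>R (- y)" unfolding z_def by (simp add: eq_neg_iff_add_eq_0)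
    then have "(1 / a) *\<^sub>R (a *\<^sub>R x) = (1 / a) *\<^sub>R (b *\<^sub>R (- y))" by simp
    then have "x = (b / a) *\<^sub>R (- y)" using ab by simp
    then have "X = opposite E Y" using ab sign_of_scale_pos[of "b / a" "- y"] x y opposite_sign_of by simp
    then show False using XY by simp
  qed
  moreover have "z \<in> S" unfolding z_def using x y subspace_S by (intro subspace_add subspace_scale)
  ultimately obtain w where w: "w \<in> S" "w \<noteq> 0" "card (zeros w) = dim S - 1"
    and wsgn: "\<And>f. f \<in> E \<Longrightarrow> v f \<bullet> w = 0 \<or> sgn (v f \<bullet> w) = sgn (v f \<bullet> z)"
    using conformal_cocircuit_exists by blast
  show "\<exists>Z\<in>cocircuits. Z e = Zero \<and> (\<forall>f\<in>E - {e}. Z f \<in> {X f, Y f, Zero})"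
  proof (intro bexI[of _ "sign_of w"] conjI ballI)
    show "sign_of w \<in> cocircuits" unfolding cocircuits_def using w by auto
    show "sign_of w e = Zero" using wsgn[OF eE] ze eE by (auto simp: sign_of_def sgn_0_0)
    fix f assume "f \<in> E - {e}"
    then have f: "f \<in> E" by simp
    have vz: "v f \<bullet> z = a * (v f \<bullet> x) + b * (v f \<bullet> y)" unfolding z_def by (simp add: inner_add_right)
    have "0 < v f \<bullet> x \<or> 0 < v f \<bullet> y" if "0 < v f \<bullet> z"
    proof (rule ccontr)
      assume "\<not> ?thesis"
      then have "a * (v f \<bullet> x) \<le> 0" "b * (v f \<bullet> y) \<le> 0" using ab by (simp_all add: mult_le_0_iff)
      then show False using that vz by linarith
    qed
    moreover have "v f \<bullet> x < 0 \<or> v f \<bullet> y < 0" if "v f \<bullet> z < 0"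
    proof (rule ccontr)
      assume "\<not> ?thesis"
      then have "a * (v f \<bullet> x) \<ge> 0" "b * (v f \<bullet> y) \<ge> 0" using ab by simp_all
      then show False using that vz by linarith
    qed
    ultimately show "sign_of w f \<in> {X f, Y f, Zero}"
      using wsgn[OF f] f unfolding x y sign_of_def by (auto simp: sgn_if split: if_splits)
  qed
qed

section \<open>Lifting nonnegative cocircuit paths to vertices\<close>

lemma three_rays_contradiction:
  assumes J: "J \<subseteq> E" "card J + 2 = dim S"
    and abc: "a \<in> E - J" "b \<in> E - J" "c \<in> E - J" "a \<noteq> b" "a \<noteq> c" "b \<noteq> c"
    and x: "x \<in> S" "zeros x = insert a J" "\<And>e. e \<in> E \<Longrightarrow> 0 \<le> v e \<bullet> x"
    and y: "y \<in> S" "zeros y = insert b J" "\<And>e. e \<in> E \<Longrightarrow> 0 \<le> v e \<bullet> y"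
    and z: "z \<in> S" "zeros z = insert c J" "\<And>e. e \<in> E \<Longrightarrow> 0 \<le> v e \<bullet> z"
  shows False
proof -
  have zero: "v e \<bullet> u = 0 \<longleftrightarrow> e \<in> zeros u" if "e \<in> E" for e u using that by (simp add: zeros_def)
  \<comment> \<open>The combination kills coordinate \<open>a\<close>, hence is a multiple of
    \<open>x\<close>. But it is positive at \<open>b\<close> and negative at \<open>c\<close>, while
    \<open>x\<close> is positive at both.\<close>
  define p where "p = (v a \<bullet> y) *\<^sub>R z - (v a \<bullet> z) *\<^sub>R y"
  have pos: "0 < v a \<bullet> y" "0 < v a \<bullet> z" "0 < v b \<bullet> z" "0 < v c \<bullet> y" "0 < v b \<bullet> x" "0 < v c \<bullet> x"
    using abc x y z zero by (auto simp: less_le)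
  have "v b \<bullet> y = 0" "v c \<bullet> z = 0" using zero abc y z by auto
  then have pb: "v b \<bullet> p > 0" and pc: "v c \<bullet> p < 0"
    unfolding p_def using pos by (auto simp: inner_diff_right)
  have fJ: "finite J" using J(1) finite_E finite_subset by blast
  have pS: "p \<in> S" unfolding p_def using y z subspace_S by (intro subspace_diff subspace_scale)
  have v0: "v j \<bullet> y = 0" "v j \<bullet> z = 0" if "j \<in> J" for j
    using that y(2) z(2) by (auto simp: zeros_def set_eq_iff)
  have "insert a J \<subseteq> zeros p"
    using abc(1) J v0 unfolding p_def by (auto simp: zeros_def inner_diff_right)
  moreover have "p \<noteq> 0" "x \<noteq> 0" using pb pos by auto
  moreover have "card (insert a J) = dim S - 1" using abc(1) J(2) fJ by simp
  moreover have "insert a J \<subseteq> E" "insert a J \<subseteq> zeros x" using abc(1) J(1) x(2) by auto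
  ultimately obtain k where k: "p = k *\<^sub>R x" using proportional[of "insert a J" x p] x(1) pS by blast
  then show False using pb pc pos by (auto simp: zero_less_mult_iff mult_less_0_iff)
qed

text \<open>\<open>Z\<close> and \<open>W\<close> differ by exchanging one zero \<open>a\<close> for
  another, \<open>b\<close>. Dropping \<open>a\<close> at \<open>x\<close> leads along an edge to a
  vertex whose tight set is \<open>J\<close> with some \<open>c\<close> added; its ray is
  nonnegative and vanishes on \<open>J\<close>, like those of \<open>Z\<close> and \<open>W\<close>,
  so \<open>c = b\<close>. The polytope enters only through the assumptions on \<open>V\<close>,
  \<open>tight\<close> and \<open>adj\<close>.\<close>

lemma cocircuit_step_lifts:
  assumes tight: "\<And>x. x \<in> V \<Longrightarrow> tight x \<subseteq> E \<and> card (tight x) = dim S - 1"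
    and inj: "inj_on tight V"
    and ray: "\<And>x. x \<in> V \<Longrightarrow> \<exists>y\<in>S. (\<forall>i\<in>tight x. v i \<bullet> y = 0) \<and> (\<forall>i\<in>E - tight x. 0 < v i \<bullet> y)"
    and edge: "\<And>x i. x \<in> V \<Longrightarrow> i \<in> tight x \<Longrightarrow> \<exists>w\<in>V. w \<noteq> x \<and> adj x w \<and> tight x - {i} \<subseteq> tight w"
    and Z: "Z \<in> cocircuits" "neg_part E Z = {}" and W: "W \<in> cocircuits" "neg_part E W = {}"
    and ZW: "card (sym_diff (zero_part E Z) (zero_part E W)) = 2"
    and x: "x \<in> V" "tight x = zero_part E Z"
  shows "\<exists>w\<in>V. tight w = zero_part E W \<and> adj x w"
proof -
  have nonneg: "0 \<le> v e \<bullet> y" if "neg_part E (sign_of y) = {}" "e \<in> E" for e y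
    using that unfolding neg_part_def sign_of_def by (auto split: if_splits)
  obtain z where z: "z \<in> S" "Z = sign_of z" "card (zeros z) = dim S - 1"
    using Z(1) unfolding cocircuits_def by auto
  obtain w where w: "w \<in> S" "W = sign_of w" "card (zeros w) = dim S - 1"
    using W(1) unfolding cocircuits_def by auto
  have "card (zeros z - zeros w) + card (zeros w - zeros z) = 2"
    using ZW z w finite_zeros by (simp add: card_Un_disjoint Int_Diff_disjoint Diff_Int_distrib2 finite_zeros disjoint_iff)
  \<comment> \<open>Both zero sets have the same size, so a symmetric difference of size 2 is a
    single exchange.\<close>
  moreover have "card (zeros z - zeros w) = card (zeros w - zeros z)"
    using card_le_sym_Diff[OF finite_zeros finite_zeros, of z w]
      card_le_sym_Diff[OF finite_zeros finite_zeros, of w z] z(3) w(3) by simp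
  ultimately have "card (zeros z - zeros w) = 1" "card (zeros w - zeros z) = 1" by simp_all
  then obtain a b where a: "zeros z - zeros w = {a}" and b: "zeros w - zeros z = {b}"
    using card_1_singletonE by metis
  define J where "J = zeros z \<inter> zeros w"
  have za: "zeros z = insert a J" "a \<notin> J" and wb: "zeros w = insert b J" "b \<notin> J" and ab: "a \<noteq> b"
    using a b unfolding J_def by blast+
  have fJ: "finite J" unfolding J_def using finite_zeros by auto
  have JE: "J \<subseteq> E" "a \<in> E" "b \<in> E" using za wb zeros_subset by blast+
  have cJ: "card J + 2 = dim S" using z(3) za fJ dim_pos by simp
  obtain w0 where w0: "w0 \<in> V" "w0 \<noteq> x" "adj x w0" "tight x - {a} \<subseteq> tight w0"
    using edge[OF x(1), of a] x(2) z(2) za by auto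
  have tx: "tight x = insert a J" using x z za by simp
  have J0: "J \<subseteq> tight w0" using w0(4) tx za by auto
  \<comment> \<open>Injectivity of \<open>tight\<close> rules out \<open>c = a\<close>, which would
    mean returning to \<open>x\<close>.\<close>
  have ne: "tight w0 \<noteq> insert a J" using inj w0 x tx by (metis inj_onD)
  have ft: "finite (tight w0)" using tight[OF w0(1)] finite_E finite_subset by blast
  have "card (tight w0 - J) = 1"
    using card_Diff_subset[OF fJ J0] tight[OF w0(1)] cJ by simp
  then obtain c where "tight w0 - J = {c}" using card_1_singletonE by metis
  then have c: "tight w0 = insert c J" "c \<notin> J" using J0 by auto
  have ca: "c \<noteq> a" using c ne by auto
  obtain y where y: "y \<in> S" "\<forall>i\<in>tight w0. v i \<bullet> y = 0" "\<forall>i\<in>E - tight w0. 0 < v i \<bullet> y"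
    using ray[OF w0(1)] by blast
  have zy: "zeros y = insert c J" using y tight[OF w0(1)] c by (force simp: zeros_def)
  have ypos: "0 \<le> v e \<bullet> y" if "e \<in> E" for e
    using y that by (cases "e \<in> tight w0") (auto intro: less_imp_le)
  have "c = b"
  proof (rule ccontr)
    assume "c \<noteq> b"
    then show False
      using three_rays_contradiction[of J a b c z w y] JE cJ za wb c ab ca z w zy ypos y(1)
        tight[OF w0(1)] nonneg Z(2) W(2) by auto
  qed
  then show ?thesis using w0 c w wb by auto
qed

text \<open>The equality of mapped lists is the invariant: it matches the walks position by position
  and later yields the length, the end vertex and the distinctness of the lifted path.\<close>

lemma cocircuit_walk_lifts:
  fixes G :: "'p pair_pre_digraph"
  assumes step: "\<And>x Z W. x \<in> pverts G \<Longrightarrow> Z \<in> cocircuits \<Longrightarrow> neg_part E Z = {} \<Longrightarrow>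
      W \<in> cocircuits \<Longrightarrow> neg_part E W = {} \<Longrightarrow>
      card (sym_diff (zero_part E Z) (zero_part E W)) = 2 \<Longrightarrow> tight x = zero_part E Z \<Longrightarrow>
      \<exists>w\<in>pverts G. tight w = zero_part E W \<and> (x, w) \<in> parcs G"
    and "p \<noteq> []" "set p \<subseteq> cocircuits" "\<forall>Z\<in>set p. neg_part E Z = {}"
    and "set (vwalk_arcs p) \<subseteq> parcs (cocircuit_graph E cocircuits)"
    and "x \<in> pverts G" "tight x = zero_part E (hd p)"
  shows "\<exists>q. q \<noteq> [] \<and> hd q = x \<and> set q \<subseteq> pverts G \<and> set (vwalk_arcs q) \<subseteq> parcs G \<and>
           map tight q = map (zero_part E) p"
  using assms(2-)
proof (induction p arbitrary: x rule: vwalk_arcs.induct)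
  case 1
  then show ?case by simp
next
  case (2 Z)
  then show ?case by (intro exI[of _ "[x]"]) auto
next
  case (3 Z W p)
  have "card (sym_diff (zero_part E Z) (zero_part E W)) = 2"
    using "3.prems"(4) by (auto simp: cocircuit_graph_def)
  then obtain w where w: "w \<in> pverts G" "tight w = zero_part E W" "(x, w) \<in> parcs G"
    using step[of x Z W] "3.prems" by auto
  have "\<exists>q. q \<noteq> [] \<and> hd q = w \<and> set q \<subseteq> pverts G \<and> set (vwalk_arcs q) \<subseteq> parcs G \<and>
           map tight q = map (zero_part E) (W # p)"
    by (rule "3.IH") (use "3.prems" w in simp_all)
  then obtain q where q: "q \<noteq> []" "hd q = w" "set q \<subseteq> pverts G" "set (vwalk_arcs q) \<subseteq> parcs G"
      "map tight q = map (zero_part E) (W # p)" by blast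
  have "vwalk_arcs (x # q) = (x, w) # vwalk_arcs q" using q by (cases q) auto
  then show ?case using q w "3.prems" by (intro exI[of _ "x # q"]) auto
qed

text \<open>Crabbedness between nonnegative ends makes every vertex of the path nonnegative. Such
  sign vectors are determined by their zero sets, so the lifted walk repeats no vertex and is again
  a path.\<close>

lemma crabbed_path_lifts:
  fixes G :: "'p pair_pre_digraph"
  assumes step: "\<And>x Z W. x \<in> pverts G \<Longrightarrow> Z \<in> cocircuits \<Longrightarrow> neg_part E Z = {} \<Longrightarrow>
      W \<in> cocircuits \<Longrightarrow> neg_part E W = {} \<Longrightarrow>
      card (sym_diff (zero_part E Z) (zero_part E W)) = 2 \<Longrightarrow> tight x = zero_part E Z \<Longrightarrow>
      \<exists>w\<in>pverts G. tight w = zero_part E W \<and> (x, w) \<in> parcs G"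
    and inj: "inj_on tight (pverts G)"
    and p: "crabbed_path E cocircuits X p Y" and XY: "neg_part E X = {}" "neg_part E Y = {}"
    and x: "x \<in> pverts G" "tight x = zero_part E X" and y: "y \<in> pverts G" "tight y = zero_part E Y"
  shows "\<exists>q. path_between G x q y \<and> length q = length p"
proof -
  have p': "p \<noteq> []" "set p \<subseteq> cocircuits" "distinct p" "hd p = X" "last p = Y"
    "set (vwalk_arcs p) \<subseteq> parcs (cocircuit_graph E cocircuits)"
    using p unfolding crabbed_path_def path_between_def vpath_def vwalk_def
    by (auto simp: cocircuit_graph_def)
  have neg: "\<forall>Z\<in>set p. neg_part E Z = {}" using p XY unfolding crabbed_path_def by auto
  obtain q where q: "q \<noteq> []" "hd q = x" "set q \<subseteq> pverts G" "set (vwalk_arcs q) \<subseteq> parcs G"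
      "map tight q = map (zero_part E) p"
    using cocircuit_walk_lifts[of G tight p x] step p' neg x by blast
  have "inj_on (zero_part E) (set p)"
  proof (rule inj_onI)
    fix Z W assume ZW: "Z \<in> set p" "W \<in> set p" and eq: "zero_part E Z = zero_part E W"
    have "Z \<in> E \<rightarrow>\<^sub>E UNIV" "W \<in> E \<rightarrow>\<^sub>E UNIV"
      using ZW p'(2) unfolding cocircuits_def sign_of_def by auto
    moreover have "Z e = W e" if "e \<in> E" for e
    proof -
      have "Z e \<noteq> Neg" "W e \<noteq> Neg" "Z e = Zero \<longleftrightarrow> W e = Zero"
        using that neg ZW eq unfolding neg_part_def zero_part_def by auto
      then show ?thesis by (metis sign.exhaust)
    qed
    ultimately show "Z = W" by (rule PiE_ext)
  qed
  then have "distinct (map tight q)" using p'(3) q(5) by (simp add: distinct_map)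
  then have dq: "distinct q" by (simp add: distinct_map)
  have len: "length q = length p" using q(5) map_eq_imp_length_eq by metis
  have "tight (last q) = zero_part E Y" using q(1,5) p'(1,5) by (metis last_map)
  then have "last q = y" using inj y q(1,3) by (metis inj_onD last_in_set subsetD)
  then have "path_between G x q y"
    using q dq unfolding path_between_def vpath_def vwalk_def by simp
  then show ?thesis using len by blast
qed

end

text \<open>Crabbed paths are assumed only inside topes; this places two given conformal cocircuits
  in a common one.\<close>

lemma conformal_extends_to_tope:
  assumes "finite C" "T0 \<subseteq> C" "conformal E T0"
  shows "\<exists>T. tope E C T \<and> T0 \<subseteq> T"
proof -
  have "finite {T. T \<subseteq> C \<and> conformal E T}" using assms(1) by simp
  then obtain T where T: "T \<subseteq> C" "conformal E T" "T0 \<subseteq> T"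
    and max: "\<forall>T'\<in>{T. T \<subseteq> C \<and> conformal E T}. T \<subseteq> T' \<longrightarrow> T = T'"
    using finite_has_maximal2[of "{T. T \<subseteq> C \<and> conformal E T}" T0] assms by auto
  then show ?thesis unfolding tope_def by blast
qed

section \<open>Facet normals of a simple polytope\<close>

lemma indep_family_of_dim:
  fixes v :: "'i \<Rightarrow> 'b::euclidean_space"
  assumes "finite I" "card I \<le> dim (span (v ` I))"
  shows "indep_family v I"
proof -
  have "dim (v ` I) \<le> card (v ` I)" using assms(1) by (intro dim_le_card') simp
  moreover have "card (v ` I) \<le> card I" using assms(1) by (rule card_image_le)
  ultimately have eq: "card (v ` I) = card I" "card (v ` I) \<le> dim (v ` I)" using assms(2) by auto
  then have "inj_on v I" using assms(1) by (simp add: eq_card_imp_inj_on)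
  moreover have "independent (v ` I)"
    using card_le_dim_spanning[OF order_refl span_superset finite_imageI[OF assms(1)] eq(2)] .
  ultimately show ?thesis unfolding indep_family_def by blast
qed

text \<open>On the way from a relative interior point \<open>z\<close> to a point \<open>y\<close>
  outside P, the segment leaves P strictly before \<open>y\<close>, on some facet \<open>F\<close>.
  There \<open>g F\<close> vanishes, although it is affine along the segment, positive at
  \<open>z\<close> and nonnegative at \<open>y\<close>.\<close>

lemma mem_polytope_of_facets:
  fixes P :: "'a::euclidean_space set" and g :: "'a set \<Rightarrow> 'a \<Rightarrow> real"
  assumes P: "polytope P" "P \<noteq> {}"
    and g_lin: "\<And>F x y t. F facet_of P \<Longrightarrow> g F (x + t *\<^sub>R (y - x)) = (1 - t) * g F x + t * g F y"
    and g: "\<And>F x. F facet_of P \<Longrightarrow> x \<in> P \<Longrightarrow> 0 \<le> g F x \<and> (g F x = 0 \<longleftrightarrow> x \<in> F)"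
    and y: "y \<in> affine hull P" "\<And>F. F facet_of P \<Longrightarrow> 0 \<le> g F y"
  shows "y \<in> P"
proof (rule ccontr)
  assume yP: "y \<notin> P"
  have poly: "polyhedron P" using P polytope_imp_polyhedron by blast
  obtain z where z: "z \<in> rel_interior P"
    using P polytope_imp_convex rel_interior_eq_empty by blast
  have zP: "z \<in> P" using z rel_interior_subset by blast
  have "y - z \<noteq> 0" using yP zP by auto
  moreover have "z + (y - z) \<in> affine hull P" using y by simp
  ultimately obtain d where d: "0 < d" "z + d *\<^sub>R (y - z) \<in> rel_frontier P"
      "\<And>e. 0 \<le> e \<Longrightarrow> e < d \<Longrightarrow> z + e *\<^sub>R (y - z) \<in> rel_interior P"
    using ray_to_rel_frontier[OF polytope_imp_bounded[OF P(1)] z] by metis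
  let ?u = "z + d *\<^sub>R (y - z)"
  obtain F where F: "F facet_of P" "?u \<in> F" using d(2) rel_frontier_of_polyhedron[OF poly] by blast
  have uP: "?u \<in> P" using F facet_of_imp_subset by blast
  have "d \<noteq> 1" using uP yP by auto
  moreover have "\<not> 1 < d" using d(3)[of 1] yP rel_interior_subset by auto
  ultimately have d1: "d < 1" by linarith
  have "z \<notin> F" using rel_boundary_of_polyhedron[OF poly] z F(1) by blast
  then have "0 < g F z" using g[OF F(1) zP] by (simp add: less_le)
  then have "0 < (1 - d) * g F z + d * g F y"
    using d d1 y(2)[OF F(1)] by (intro add_pos_nonneg) simp_all
  then have "0 < g F ?u" using g_lin[OF F(1)] by simp
  then show False using g[OF F(1) uP] F(2) by simp
qed

text \<open>The inequality of the facet is homogenised so that its slack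
  \<open>b - a \<bullet> x\<close> becomes an inner product. The normal is replaced by its
  projection to \<open>L\<close>, which does not change its products with differences of points of
  P.\<close>

lemma facet_normal_exists:
  fixes P :: "'a::euclidean_space set"
  assumes P: "polytope P" "x0 \<in> P" and L: "L = span ((\<lambda>x. x - x0) ` P)" and F: "F facet_of P"
  shows "\<exists>v\<in>L \<times> (UNIV :: real set). \<forall>x\<in>P. 0 \<le> v \<bullet> (x - x0, 1) \<and> (v \<bullet> (x - x0, 1) = 0 \<longleftrightarrow> x \<in> F)"
proof -
  obtain a b where ab: "P \<subseteq> {x. a \<bullet> x \<le> b}" "F = P \<inter> {x. a \<bullet> x = b}"
    using facet_of_polyhedron[OF polytope_imp_polyhedron[OF P(1)] F] by metis
  obtain p q where p: "p \<in> L" and q: "\<And>w. w \<in> L \<Longrightarrow> orthogonal q w" and pq: "a = p + q"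
    using orthogonal_subspace_decomp_exists[of "(\<lambda>x. x - x0) ` P" a] L by metis
  have "(- p, b - a \<bullet> x0) \<bullet> (x - x0, 1::real) = b - a \<bullet> x" if "x \<in> P" for x
  proof -
    have "x - x0 \<in> L" unfolding L using that by (intro span_base) auto
    then have "q \<bullet> (x - x0) = 0" using q by (simp add: orthogonal_def)
    then show ?thesis using pq by (simp add: algebra_simps)
  qed
  moreover have "- p \<in> L" using p L by (simp add: span_neg)
  ultimately show ?thesis
    using ab by (intro bexI[of _ "(- p, b - a \<bullet> x0)"]) (auto simp del: inner_Pair)
qed

text \<open>Facets carry indices from \<open>E\<close> because they are to become the ground set of
  an oriented matroid, which in the end consists of natural numbers.\<close>

locale simple_polytope_normals =
  fixes P :: "'a::euclidean_space set" and d :: nat and E :: "'i set" and Fa :: "'i \<Rightarrow> 'a set"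
    and x0 :: 'a and L :: "'a set" and v :: "'i \<Rightarrow> 'a \<times> real"
  assumes simple: "simple_polytope P" and aff_dim_P: "aff_dim P = int d" and d_pos: "1 \<le> d"
    and finite_E: "finite E" and facets: "bij_betw Fa E {F. F facet_of P}"
    and x0: "x0 \<in> P" and L_def: "L = span ((\<lambda>x. x - x0) ` P)"
    and v_in: "\<And>i. i \<in> E \<Longrightarrow> v i \<in> L \<times> UNIV"
    and v_sign: "\<And>i x. i \<in> E \<Longrightarrow> x \<in> P \<Longrightarrow>
      0 \<le> v i \<bullet> (x - x0, 1) \<and> (v i \<bullet> (x - x0, 1) = 0 \<longleftrightarrow> x \<in> Fa i)"
begin

definition hom :: "'a \<Rightarrow> 'a \<times> real" where "hom x = (x - x0, 1)"

definition tight :: "'a \<Rightarrow> 'i set" where "tight x = {i \<in> E. x \<in> Fa i}"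

lemma polytope_P: "polytope P" and polyhedron_P: "polyhedron P"
  using simple polytope_imp_polyhedron unfolding simple_polytope_def by auto

lemma facet_Fa: "i \<in> E \<Longrightarrow> Fa i facet_of P" using facets bij_betwE by blast

lemma subspace_L: "subspace L" unfolding L_def by (rule subspace_span)

lemma subspace_LR: "subspace (L \<times> (UNIV :: real set))"
  by (intro subspace_Times subspace_L subspace_UNIV)

lemma dim_LR: "dim (L \<times> (UNIV :: real set)) = d + 1"
proof -
  have "aff_dim P = int (dim L)"
    using aff_dim_eq_dim_subtract[of x0 P] x0 unfolding L_def by (simp add: hull_inc)
  then have "dim L = d" using aff_dim_P by simp
  then show ?thesis using dim_Times[OF subspace_L subspace_UNIV[where 'a = real]] by simp
qed

lemma hom_in: "x \<in> P \<Longrightarrow> hom x \<in> L \<times> UNIV"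
  unfolding hom_def L_def by (auto intro: span_base)

lemma v_tight_subset: "v ` tight x \<subseteq> L \<times> UNIV"
  using v_in unfolding tight_def by blast

lemma diff_scale_in_L:
  assumes "y \<in> L \<times> UNIV" "x \<in> P"
  shows "fst y - c *\<^sub>R (x - x0) \<in> L"
proof -
  have "fst y \<in> L" "x - x0 \<in> L" using assms(1) hom_in[OF assms(2)] by (auto simp: hom_def)
  then show ?thesis using subspace_L by (meson subspace_diff subspace_scale)
qed

lemma v_hom: "i \<in> E \<Longrightarrow> x \<in> P \<Longrightarrow> 0 \<le> v i \<bullet> hom x"
  and v_hom_eq_0: "i \<in> E \<Longrightarrow> x \<in> P \<Longrightarrow> v i \<bullet> hom x = 0 \<longleftrightarrow> i \<in> tight x"
  using v_sign unfolding hom_def tight_def by auto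

lemma hom_shift: "hom (x + t *\<^sub>R g) = hom x + t *\<^sub>R (g, 0)"
  unfolding hom_def by simp

lemma v_hom_shift: "v i \<bullet> hom (x + t *\<^sub>R g) = v i \<bullet> hom x + t * (v i \<bullet> (g, 0))"
  unfolding hom_shift inner_add_right inner_scaleR_right ..

lemma mem_P:
  assumes y: "y - x0 \<in> L" "\<And>i. i \<in> E \<Longrightarrow> 0 \<le> v i \<bullet> hom y"
  shows "y \<in> P"
proof (rule mem_polytope_of_facets[OF polytope_P, where g = "\<lambda>F x. v (inv_into E Fa F) \<bullet> hom x"])
  have "x0 \<in> affine hull P" using x0 by (rule hull_inc)
  then have "affine hull P = (\<lambda>x. x0 + x) ` L"
    using affine_hull_span_gen[of x0 P] unfolding L_def by simp
  then show "y \<in> affine hull P" using y(1) by (auto intro!: image_eqI[of _ _ "y - x0"])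
  show "P \<noteq> {}" using x0 by auto
next
  fix F assume F: "F facet_of P"
  then have i: "inv_into E Fa F \<in> E" "Fa (inv_into E Fa F) = F"
    using facets by (auto simp: bij_betw_def inv_into_into f_inv_into_f)
  show "0 \<le> v (inv_into E Fa F) \<bullet> hom y" by (rule y(2)[OF i(1)])
  fix x z and t :: real
  show "v (inv_into E Fa F) \<bullet> hom (x + t *\<^sub>R (z - x)) =
      (1 - t) * (v (inv_into E Fa F) \<bullet> hom x) + t * (v (inv_into E Fa F) \<bullet> hom z)"
    unfolding hom_def by (cases "v (inv_into E Fa F)") (simp add: algebra_simps)
  show "x \<in> P \<Longrightarrow> 0 \<le> v (inv_into E Fa F) \<bullet> hom x \<and> (v (inv_into E Fa F) \<bullet> hom x = 0 \<longleftrightarrow> x \<in> F)"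
    using v_sign[OF i(1)] i(2) unfolding hom_def by auto
qed

section \<open>Tight facets at a vertex and the edges leaving it\<close>

lemma move_within_P:
  assumes x: "x \<in> P" and g: "g \<in> L" "\<And>i. i \<in> tight x \<Longrightarrow> 0 \<le> v i \<bullet> (g, 0)"
  shows "\<exists>t>0. x + t *\<^sub>R g \<in> P"
proof -
  have "eventually (\<lambda>t. 0 < v i \<bullet> hom (x + t *\<^sub>R g)) (at_right 0)" if i: "i \<in> E - tight x" for i
  proof -
    have "((\<lambda>t. v i \<bullet> hom (x + t *\<^sub>R g)) \<longlongrightarrow> v i \<bullet> (hom x + 0 *\<^sub>R (g, 0))) (at_right 0)"
      unfolding hom_shift by (intro tendsto_intros)
    moreover have "0 < v i \<bullet> hom x" using i v_hom[OF _ x, of i] v_hom_eq_0[OF _ x, of i] by auto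
    ultimately show ?thesis by (intro order_tendstoD(1)[where y = "v i \<bullet> (hom x + 0 *\<^sub>R (g, 0))"]) (simp_all add: zero_prod_def[symmetric])
  qed
  then have "eventually (\<lambda>t. \<forall>i\<in>E - tight x. 0 < v i \<bullet> hom (x + t *\<^sub>R g)) (at_right 0)"
    using finite_E by (intro eventually_ball_finite) auto
  moreover have "eventually (\<lambda>t::real. 0 < t) (at_right 0)" by (rule eventually_at_right_less)
  ultimately obtain t where t: "0 < t" "\<forall>i\<in>E - tight x. 0 < v i \<bullet> hom (x + t *\<^sub>R g)"
    using eventually_happens[OF eventually_conj] trivial_limit_at_right_real by blast
  have "x + t *\<^sub>R g \<in> P"
  proof (rule mem_P)
    have "(x - x0) + t *\<^sub>R g \<in> L"
      using hom_in[OF x] g(1) subspace_L by (intro subspace_add subspace_scale) (auto simp: hom_def)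
    then show "x + t *\<^sub>R g - x0 \<in> L" by (simp add: algebra_simps)
    show "0 \<le> v i \<bullet> hom (x + t *\<^sub>R g)" if "i \<in> E" for i
    proof (cases "i \<in> tight x")
      case True
      then have "v i \<bullet> hom x = 0" using v_hom_eq_0[OF that x] by simp
      then show ?thesis using g(2)[OF True] t(1) by (simp add: v_hom_shift)
    next
      case False
      then show ?thesis using t(2) that by (auto intro: less_imp_le)
    qed
  qed
  then show ?thesis using t(1) by blast
qed

text \<open>A vertex is a proper face because \<open>d\<close> is positive, hence it is the
  intersection of the facets through it.\<close>

lemma extreme_eqI:
  assumes x: "x extreme_point_of P" and y: "y \<in> P" "tight x \<subseteq> tight y"
  shows "y = x"
proof -
  have "{x} \<noteq> P" using aff_dim_P d_pos aff_dim_sing[of x] by auto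
  moreover have "{x} face_of P" using x by (simp add: face_of_singleton)
  ultimately have eq: "{x} = \<Inter> {F. F facet_of P \<and> {x} \<subseteq> F}"
    using face_of_polyhedron[OF polyhedron_P] by blast
  have "y \<in> F" if "F facet_of P" "x \<in> F" for F
  proof -
    obtain i where "i \<in> E" "F = Fa i" using facets \<open>F facet_of P\<close> by (auto simp: bij_betw_def)
    then show ?thesis using y(2) that(2) unfolding tight_def by auto
  qed
  then have "y \<in> \<Inter> {F. F facet_of P \<and> {x} \<subseteq> F}" by auto
  then show ?thesis using eq by blast
qed

lemma extreme_in_P: "x extreme_point_of P \<Longrightarrow> x \<in> P" by (simp add: extreme_point_of_def)

lemma inj_on_tight: "inj_on tight {x. x extreme_point_of P}"
  by (rule inj_onI) (use extreme_eqI extreme_in_P in auto)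

lemma card_tight:
  assumes "x extreme_point_of P"
  shows "card (tight x) = d"
proof -
  have "Fa ` tight x = {F. F facet_of P \<and> x \<in> F}"
    using facets unfolding tight_def by (auto simp: bij_betw_def)
  moreover have "inj_on Fa (tight x)"
    using facets unfolding tight_def bij_betw_def by (auto intro: inj_on_subset)
  ultimately have "card (tight x) = card {F. F facet_of P \<and> x \<in> F}" by (metis card_image)
  then show ?thesis using simple assms aff_dim_P unfolding simple_polytope_def by auto
qed

text \<open>After subtracting a multiple of \<open>hom x\<close>, what remains is a direction
  \<open>g\<close> that leaves all tight constraints at 0. A short step along \<open>g\<close> stays
  in P and in the same facets, so it does not move \<open>x\<close>, and
  \<open>g = 0\<close>.\<close>

lemma tight_orthogonal:
  assumes x: "x extreme_point_of P" and y: "y \<in> L \<times> UNIV" "\<And>i. i \<in> tight x \<Longrightarrow> v i \<bullet> y = 0"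
  shows "y = snd y *\<^sub>R hom x"
proof -
  have xP: "x \<in> P" using x by (rule extreme_in_P)
  define g where "g = fst y - snd y *\<^sub>R (x - x0)"
  have g0: "(g, 0) = y - snd y *\<^sub>R hom x" unfolding g_def hom_def by (cases y) simp
  have gL: "g \<in> L" unfolding g_def by (rule diff_scale_in_L[OF y(1) xP])
  have vg: "v i \<bullet> (g, 0) = 0" if "i \<in> tight x" for i
    using y(2)[OF that] v_hom_eq_0[OF _ xP, of i] that unfolding g0
    by (simp add: inner_diff_right tight_def)
  obtain t where t: "t > 0" "x + t *\<^sub>R g \<in> P" using move_within_P[OF xP gL] vg by auto
  have "tight x \<subseteq> tight (x + t *\<^sub>R g)"
  proof
    fix i assume i: "i \<in> tight x"
    then have "i \<in> E" "v i \<bullet> hom x = 0" using v_hom_eq_0[OF _ xP] by (auto simp: tight_def)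
    then show "i \<in> tight (x + t *\<^sub>R g)"
      using v_hom_eq_0[OF _ t(2), of i] vg[OF i] by (simp add: v_hom_shift)
  qed
  then have "x + t *\<^sub>R g = x" by (rule extreme_eqI[OF x t(2)])
  then have "g = 0" using t(1) by simp
  then show ?thesis using g0 by (simp add: zero_prod_def[symmetric])
qed

text \<open>The vectors orthogonal to the tight normals lie on one line, so these normals span at
  least dimension \<open>d\<close>. Simplicity says that there are only \<open>d\<close> of
  them.\<close>

lemma indep_tight:
  assumes x: "x extreme_point_of P"
  shows "indep_family v (tight x)"
proof (rule indep_family_of_dim)
  show "finite (tight x)" using finite_E unfolding tight_def by simp
  let ?A = "span (v ` tight x)" and ?S = "L \<times> (UNIV :: real set)"
  have "?A \<subseteq> ?S" using v_tight_subset subspace_LR by (rule span_minimal)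
  then have dims: "dim {y \<in> ?S. \<forall>x\<in>?A. orthogonal x y} + dim ?A = d + 1"
    using dim_subspace_orthogonal_to_vectors[OF subspace_span subspace_LR] dim_LR by simp
  have "{y \<in> ?S. \<forall>x\<in>?A. orthogonal x y} \<subseteq> span {hom x}"
  proof
    fix y assume y: "y \<in> {y \<in> ?S. \<forall>x\<in>?A. orthogonal x y}"
    have "v i \<bullet> y = 0" if "i \<in> tight x" for i
      using y that by (auto simp: orthogonal_def span_base)
    then have "y = snd y *\<^sub>R hom x" using tight_orthogonal[OF x] y by blast
    then show "y \<in> span {hom x}" by (metis singletonI span_base span_scale)
  qed
  then have "dim {y \<in> ?S. \<forall>x\<in>?A. orthogonal x y} \<le> dim (span {hom x})" by (rule dim_subset)
  also have "\<dots> \<le> card {hom x}" by (simp only: dim_span) (rule dim_le_card', simp)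
  finally show "card (tight x) \<le> dim ?A" using dims card_tight[OF x] by simp
qed

lemma cuts_vertex_tight:
  assumes x: "x extreme_point_of P"
  shows "cuts_vertex (L \<times> UNIV) E v (tight x)"
  unfolding cuts_vertex_def
proof (intro conjI bexI[of _ "hom x"] ballI)
  have xP: "x \<in> P" using x by (rule extreme_in_P)
  show "indep_family v (tight x)" by (rule indep_tight[OF x])
  show "hom x \<in> L \<times> UNIV" by (rule hom_in[OF xP])
  show "v i \<bullet> hom x = 0" if "i \<in> tight x" for i
    using that v_hom_eq_0[OF _ xP, of i] by (auto simp: tight_def)
  show "0 < v i \<bullet> hom x" if "i \<in> E - tight x" for i
    using that v_hom_eq_0[OF _ xP, of i] v_hom[OF _ xP, of i] by auto
qed

text \<open>The vector dual to \<open>v i\<close> gives a direction \<open>g\<close> that relaxes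
  constraint \<open>i\<close> and keeps the other tight ones. The face \<open>C\<close> cut out by
  those others lies on the line through \<open>x\<close> along \<open>g\<close>, so it is a segment
  ending at \<open>x\<close>; a short step along \<open>g\<close> shows that it is not a
  point.\<close>

lemma edge_exists:
  assumes x: "x extreme_point_of P" and i: "i \<in> tight x"
  shows "\<exists>w. w extreme_point_of P \<and> w \<noteq> x \<and> closed_segment x w edge_of P \<and> tight x - {i} \<subseteq> tight w"
proof -
  have xP: "x \<in> P" using x by (rule extreme_in_P)
  have tE: "tight x \<subseteq> E" unfolding tight_def by auto
  have vx: "v j \<bullet> hom x = 0" if "j \<in> tight x" for j using that tE v_hom_eq_0[OF _ xP] by auto
  then obtain u where u: "u \<in> L \<times> UNIV" "v i \<bullet> u = 1" "\<And>j. j \<in> tight x - {i} \<Longrightarrow> v j \<bullet> u = 0"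
    using dual_vector_exists[OF subspace_LR v_tight_subset indep_tight[OF x] i] by blast
  define g where "g = fst u - snd u *\<^sub>R (x - x0)"
  have g0: "(g, 0) = u - snd u *\<^sub>R hom x" unfolding g_def hom_def by (cases u) simp
  have gL: "g \<in> L" unfolding g_def by (rule diff_scale_in_L[OF u(1) xP])
  have vg: "v j \<bullet> (g, 0) = (if j = i then 1 else 0)" if "j \<in> tight x" for j
    using u(2) u(3)[of j] vx[OF that] that unfolding g0 by (auto simp: inner_diff_right)
  have "g \<noteq> 0"
  proof
    assume "g = 0"
    then have "v i \<bullet> (g, 0) = 0" by (simp add: zero_prod_def[symmetric])
    then show False using vg[OF i] by simp
  qed
  \<comment> \<open>Inserting \<open>P\<close> covers \<open>d = 1\<close>, where no other tight
    facet exists and the empty intersection would be the whole space.\<close>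
  define C where "C = \<Inter> (insert P (Fa ` (tight x - {i})))"
  have C_face: "C face_of P" unfolding C_def
  proof (rule face_of_Inter)
    show "T face_of P" if "T \<in> insert P (Fa ` (tight x - {i}))" for T
      using that facet_Fa tE facet_of_imp_face_of face_of_refl[OF polytope_imp_convex[OF polytope_P]]
      by auto
  qed simp
  have C_iff: "q \<in> C \<longleftrightarrow> q \<in> P \<and> tight x - {i} \<subseteq> tight q" for q
    unfolding C_def tight_def by auto
  have line: "\<exists>t. q = x + t *\<^sub>R g" if "q \<in> C" for q
  proof -
    have q: "q \<in> P" "tight x - {i} \<subseteq> tight q" using that C_iff by auto
    define \<beta> where "\<beta> = v i \<bullet> hom q"
    \<comment> \<open>Removing \<open>\<beta> *\<^sub>R u\<close> makes constraint \<open>i\<close>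
      vanish too, so \<open>y\<close> is orthogonal to all tight normals and thus a multiple of
      \<open>hom x\<close>.\<close>
    define y where "y = hom q - \<beta> *\<^sub>R u"
    have "v j \<bullet> y = 0" if j: "j \<in> tight x" for j
    proof (cases "j = i")
      case True
      then show ?thesis using u(2) unfolding y_def \<beta>_def by (simp add: inner_diff_right)
    next
      case False
      then have "v j \<bullet> hom q = 0" using q j tE v_hom_eq_0[OF _ q(1)] by blast
      then show ?thesis using u(3)[of j] j False unfolding y_def by (simp add: inner_diff_right)
    qed
    moreover have "y \<in> L \<times> UNIV" unfolding y_def
      using hom_in[OF q(1)] u(1) subspace_LR by (intro subspace_diff subspace_scale)
    ultimately have "y = snd y *\<^sub>R hom x" by (intro tight_orthogonal[OF x])
    then have "fst y = snd y *\<^sub>R (x - x0)" unfolding hom_def by (metis fst_conv fst_scaleR)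
    then have "q - x0 = \<beta> *\<^sub>R fst u + (1 - \<beta> * snd u) *\<^sub>R (x - x0)"
      unfolding y_def hom_def by (simp add: algebra_simps)
    then have "q = x + \<beta> *\<^sub>R g" unfolding g_def by (simp add: algebra_simps)
    then show ?thesis by blast
  qed
  have xC: "x \<in> C" using C_iff xP by auto
  have "collinear C" unfolding collinear_def
  proof (intro exI[of _ g] ballI)
    fix p q assume "p \<in> C" "q \<in> C"
    then obtain s t where "p = x + s *\<^sub>R g" "q = x + t *\<^sub>R g" using line by blast
    then show "\<exists>c. p - q = c *\<^sub>R g" by (intro exI[of _ "s - t"]) (simp add: algebra_simps)
  qed
  moreover have "convex C" using C_face face_of_imp_convex by blast
  moreover have "compact C"
    using C_face face_of_imp_compact polytope_imp_convex polytope_imp_compact polytope_P by blast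
  ultimately obtain a b where ab: "C = closed_segment a b"
    using compact_convex_collinear_segment[of C] xC by blast
  have "x extreme_point_of C" using x xC extreme_point_of_face[OF C_face] by blast
  then have "x = a \<or> x = b" using ab extreme_point_of_segment by metis
  then obtain w where w: "C = closed_segment x w" using ab closed_segment_commute by metis
  have "0 \<le> v j \<bullet> (g, 0)" if "j \<in> tight x" for j using vg[OF that] by (cases "j = i") simp_all
  then obtain t where t: "t > 0" "x + t *\<^sub>R g \<in> P" using move_within_P[OF xP gL] by blast
  have "tight x - {i} \<subseteq> tight (x + t *\<^sub>R g)"
  proof
    fix j assume j: "j \<in> tight x - {i}"
    then show "j \<in> tight (x + t *\<^sub>R g)"
      using v_hom_eq_0[OF _ t(2), of j] vg[of j] vx[of j] tE by (auto simp: v_hom_shift)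
  qed
  then have "x + t *\<^sub>R g \<in> closed_segment x w" using t C_iff w by blast
  then have wx: "w \<noteq> x" using t \<open>g \<noteq> 0\<close> by auto
  have wC: "w \<in> C" using w by simp
  have "w extreme_point_of closed_segment x w" using extreme_point_of_segment by blast
  then have wext: "w extreme_point_of P" using w extreme_point_of_face[OF C_face] by metis
  have "aff_dim (closed_segment x w) = 1"
    using wx by (simp add: segment_convex_hull aff_dim_convex_hull aff_dim_2)
  then have "closed_segment x w edge_of P" using C_face w unfolding edge_of_def by simp
  then show ?thesis using wext wx wC C_iff by blast
qed

end

lemma simple_polytope_normals_exist:
  fixes P :: "'a::euclidean_space set"
  assumes "simple_polytope P" "aff_dim P = int d" "1 \<le> d"
    "finite E" "bij_betw Fa E {F. F facet_of P}"
  shows "\<exists>x0 L v. simple_polytope_normals P d E Fa x0 L v"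
proof -
  have poly: "polytope P" using assms(1) unfolding simple_polytope_def by blast
  have "P \<noteq> {}" using assms(2) by auto
  then obtain x0 where x0: "x0 \<in> P" by blast
  define L where "L = span ((\<lambda>x. x - x0) ` P)"
  have "\<forall>i\<in>E. \<exists>v. v \<in> L \<times> (UNIV :: real set) \<and>
      (\<forall>x\<in>P. 0 \<le> v \<bullet> (x - x0, 1) \<and> (v \<bullet> (x - x0, 1) = 0 \<longleftrightarrow> x \<in> Fa i))"
    using facet_normal_exists[OF poly x0 L_def] assms(5) bij_betwE by blast
  then obtain v where "\<forall>i\<in>E. v i \<in> L \<times> (UNIV :: real set) \<and>
      (\<forall>x\<in>P. 0 \<le> v i \<bullet> (x - x0, 1) \<and> (v i \<bullet> (x - x0, 1) = 0 \<longleftrightarrow> x \<in> Fa i))"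
    by (subst (asm) bchoice_iff) blast
  then have "simple_polytope_normals P d E Fa x0 L v"
    using assms x0 L_def by unfold_locales blast+
  then show ?thesis by blast
qed

section \<open>Crabbed paths give short polytope paths\<close>

lemma crabbed_imp_short_path:
  fixes P :: "'a::euclidean_space set" and d f :: nat
  assumes crabbed:
    "\<forall>(E :: nat set) C r T X Y.
       uniform_oriented_matroid E C r \<longrightarrow> tope E C T \<longrightarrow> X \<in> T \<longrightarrow> Y \<in> T \<longrightarrow>
       (\<exists>p. crabbed_path E C X p Y \<and> vwalk_length p \<le> card E - r + 1)"
    and P: "simple_polytope P" and d: "aff_dim P = int d" and f: "card {F. F facet_of P} = f"
    and "a \<noteq> b" and a: "a extreme_point_of P" and b: "b extreme_point_of P"
  shows "\<exists>q. path_between (polytope_graph P) a q b \<and> vwalk_length q \<le> f - d"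
proof -
  let ?G = "polytope_graph P" and ?E = "{..<f}"
  have "d \<noteq> 0"
  proof
    assume "d = 0"
    then obtain c where "P = {c}" using d aff_dim_eq_0[of P] by auto
    then show False using a b \<open>a \<noteq> b\<close> by (auto simp: extreme_point_of_def)
  qed
  then have d1: "1 \<le> d" by simp
  have "finite {F. F facet_of P}" using P finite_polytope_facets unfolding simple_polytope_def by blast
  then obtain Fa where Fa: "bij_betw Fa ?E {F. F facet_of P}"
    using ex_bij_betw_nat_finite[of "{F. F facet_of P}"] f by (auto simp: atLeast0LessThan)
  obtain x0 L v where "simple_polytope_normals P d ?E Fa x0 L v"
    using simple_polytope_normals_exist[OF P d d1 _ Fa] by auto
  then interpret N: simple_polytope_normals P d ?E Fa x0 L v .
  let ?S = "L \<times> (UNIV :: real set)"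
  have tight_E: "N.tight x \<subseteq> ?E" for x unfolding N.tight_def by blast
  \<comment> \<open>Needed for the rank \<open>d + 1\<close> not to exceed the number of elements.
    Otherwise every vertex would lie on all facets, and \<open>a\<close> and \<open>b\<close> would
    coincide.\<close>
  have "d < f"
  proof (rule ccontr)
    assume "\<not> d < f"
    then have "N.tight x = ?E" if "x extreme_point_of P" for x
      using card_subset_eq[OF _ tight_E, of x] N.card_tight[OF that] card_mono[OF _ tight_E, of x] by simp
    then show False using inj_onD[OF N.inj_on_tight, of a b] a b \<open>a \<noteq> b\<close> by simp
  qed
  obtain w where w: "w ` ?E \<subseteq> ?S"
      "\<forall>I\<in>N.tight ` {x. x extreme_point_of P}. cuts_vertex ?S ?E w I"
      "\<forall>J\<subseteq>?E. card J \<le> dim ?S \<longrightarrow> indep_family w J"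
  proof -
    have "\<exists>w. w ` ?E \<subseteq> ?S \<and>
        (\<forall>I\<in>N.tight ` {x. x extreme_point_of P}. cuts_vertex ?S ?E w I) \<and>
        (\<forall>J\<subseteq>?E. card J \<le> dim ?S \<longrightarrow> indep_family w J)"
    proof (rule generic_perturbation[OF N.subspace_LR])
      show "finite ?E" by simp
      show "v ` ?E \<subseteq> ?S" using N.v_in by blast
      show "finite (N.tight ` {x. x extreme_point_of P})"
        using finite_polyhedron_extreme_points[OF N.polyhedron_P] by simp
      show "I \<subseteq> ?E" if "I \<in> N.tight ` {x. x extreme_point_of P}" for I
        using that tight_E by blast
      show "cuts_vertex ?S ?E v I" if "I \<in> N.tight ` {x. x extreme_point_of P}" for I
        using that N.cuts_vertex_tight by blast
    qed
    then show ?thesis using that by blast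
  qed
  interpret M: generic_vectors ?S ?E w
  proof
    show "subspace ?S" by (rule N.subspace_LR)
    show "finite ?E" by simp
    show "w ` ?E \<subseteq> ?S" by (rule w(1))
    show "indep_family w J" if "J \<subseteq> ?E" "card J \<le> dim ?S" for J using w(3) that by blast
    show "1 \<le> dim ?S" "dim ?S \<le> card ?E" unfolding N.dim_LR using \<open>d < f\<close> by simp_all
  qed
  have rank: "dim ?S = d + 1" by (rule N.dim_LR)
  have ray: "\<exists>y\<in>?S. (\<forall>i\<in>N.tight x. w i \<bullet> y = 0) \<and> (\<forall>i\<in>?E - N.tight x. 0 < w i \<bullet> y)"
    if "x extreme_point_of P" for x
    using w(2) that unfolding cuts_vertex_def by blast
  have cocircuit: "\<exists>X\<in>M.cocircuits. neg_part ?E X = {} \<and> zero_part ?E X = N.tight x"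
    if x: "x extreme_point_of P" for x
  proof -
    obtain y where y: "y \<in> ?S" "\<forall>i\<in>N.tight x. w i \<bullet> y = 0" "\<forall>i\<in>?E - N.tight x. 0 < w i \<bullet> y"
      using ray[OF x] by blast
    have zeros: "M.zeros y = N.tight x"
    proof (rule set_eqI)
      fix i show "i \<in> M.zeros y \<longleftrightarrow> i \<in> N.tight x"
        using y(2) bspec[OF y(3), of i] tight_E[of x] by (cases "i \<in> N.tight x") (auto simp: M.zeros_def)
    qed
    have "N.tight x \<noteq> ?E" using N.card_tight[OF x] \<open>d < f\<close> by (metis card_lessThan less_irrefl)
    then obtain i where "i \<in> ?E - N.tight x" using tight_E[of x] by blast
    then have "0 < w i \<bullet> y" using y(3) by blast
    then have "y \<noteq> 0" by auto
    then have "M.sign_of y \<in> M.cocircuits"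
      using y(1) zeros N.card_tight[OF x] rank unfolding M.cocircuits_def by auto
    moreover have "\<not> w i \<bullet> y < 0" if "i \<in> ?E" for i
      using y(2) bspec[OF y(3), of i] that by (cases "i \<in> N.tight x") auto
    then have "neg_part ?E (M.sign_of y) = {}"
      unfolding neg_part_def M.sign_of_def by auto
    ultimately show ?thesis using zeros by (intro bexI[of _ "M.sign_of y"]) simp_all
  qed
  obtain X where X: "X \<in> M.cocircuits" "neg_part ?E X = {}" "zero_part ?E X = N.tight a"
    using cocircuit[OF a] by blast
  obtain Y where Y: "Y \<in> M.cocircuits" "neg_part ?E Y = {}" "zero_part ?E Y = N.tight b"
    using cocircuit[OF b] by blast
  \<comment> \<open>Nonnegative sign vectors never disagree in sign, so the two cocircuits fit into
    one tope.\<close>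
  have "conformal ?E {X, Y}"
    using X(2) Y(2) unfolding conformal_def separator_def neg_part_def
    by (auto simp: doubleton_eq_iff)
  moreover have "finite M.cocircuits" by (rule M.finite_cocircuits)
  ultimately obtain T where T: "tope ?E M.cocircuits T" "{X, Y} \<subseteq> T"
    using conformal_extends_to_tope[of M.cocircuits "{X, Y}" ?E] X Y by auto
  then have "X \<in> T" "Y \<in> T" by auto
  then obtain p where p: "crabbed_path ?E M.cocircuits X p Y" "vwalk_length p \<le> card ?E - dim ?S + 1"
    using crabbed[rule_format, OF M.uniform_oriented_matroid_cocircuits T(1)] by blast
  have step: "\<exists>z\<in>pverts ?G. N.tight z = zero_part ?E W \<and> (x, z) \<in> parcs ?G"
    if "x \<in> pverts ?G" "Z \<in> M.cocircuits" "neg_part ?E Z = {}"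
      "W \<in> M.cocircuits" "neg_part ?E W = {}"
      "card (sym_diff (zero_part ?E Z) (zero_part ?E W)) = 2" "N.tight x = zero_part ?E Z" for x Z W
  proof (rule M.cocircuit_step_lifts[of "pverts ?G" N.tight "\<lambda>x z. (x, z) \<in> parcs ?G" Z W])
    show "N.tight x \<subseteq> ?E \<and> card (N.tight x) = dim ?S - 1" if "x \<in> pverts ?G" for x
      using that tight_E N.card_tight rank by (simp add: polytope_graph_def)
    show "inj_on N.tight (pverts ?G)" using N.inj_on_tight by (simp add: polytope_graph_def)
    show "\<exists>y\<in>?S. (\<forall>i\<in>N.tight x. w i \<bullet> y = 0) \<and> (\<forall>i\<in>?E - N.tight x. 0 < w i \<bullet> y)"
      if "x \<in> pverts ?G" for x
      using that ray by (simp add: polytope_graph_def)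
    show "\<exists>z\<in>pverts ?G. z \<noteq> x \<and> (x, z) \<in> parcs ?G \<and> N.tight x - {i} \<subseteq> N.tight z"
      if "x \<in> pverts ?G" "i \<in> N.tight x" for x i
      using that N.edge_exists[of x i] unfolding polytope_graph_def by auto
  qed (use that in auto)
  have "\<exists>q. path_between ?G a q b \<and> length q = length p"
  proof (rule M.crabbed_path_lifts[OF step _ p(1)])
    show "inj_on N.tight (pverts ?G)" using N.inj_on_tight by (simp add: polytope_graph_def)
    show "a \<in> pverts ?G" "b \<in> pverts ?G" using a b by (simp_all add: polytope_graph_def)
  qed (use X Y in simp_all)
  \<comment> \<open>By \<open>d < f\<close>, the truncated subtraction gives
    \<open>f - (d + 1) + 1 = f - d\<close>.\<close>
  then show ?thesis using p(2) rank \<open>d < f\<close> by auto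
qed

theorem mainTheorem3:
  fixes P :: "'a::euclidean_space set" and d f :: nat
  assumes crabbed:
    "\<forall>(E :: nat set) C r T X Y.
       uniform_oriented_matroid E C r \<longrightarrow> tope E C T \<longrightarrow> X \<in> T \<longrightarrow> Y \<in> T \<longrightarrow>
       (\<exists>p. crabbed_path E C X p Y \<and> vwalk_length p \<le> card E - r + 1)"
    and "simple_polytope P"
    and "aff_dim P = int d"
    and "card {F. F facet_of P} = f"
  shows "graph_diameter (polytope_graph P) \<le> enat (f - d)"
proof -
  let ?G = "polytope_graph P"
  have short: "\<exists>q. path_between ?G a q b \<and> vwalk_length q \<le> f - d"
    if "a \<in> pverts ?G" "b \<in> pverts ?G" for a b
  proof (cases "a = b")
    \<comment> \<open>The trivial path is treated apart because the crabbed path argument requires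
      two different vertices.\<close>
    case True
    then show ?thesis using that
      by (intro exI[of _ "[a]"]) (simp add: path_between_def vpath_def vwalk_def)
  next
    case False
    have ab: "a extreme_point_of P" "b extreme_point_of P"
      using that by (auto simp: polytope_graph_def)
    then show ?thesis by (rule crabbed_imp_short_path[OF assms False])
  qed
  have "graph_distance ?G a b \<le> enat (f - d)" if ab: "a \<in> pverts ?G" "b \<in> pverts ?G" for a b
  proof -
    obtain q where q: "path_between ?G a q b" "vwalk_length q \<le> f - d"
      using short[OF ab] by blast
    have "graph_distance ?G a b \<le> enat (vwalk_length q)"
      unfolding graph_distance_def by (rule INF_lower) (use q in simp)
    also have "\<dots> \<le> enat (f - d)" using q by simp
    finally show ?thesis .
  qed
  then show ?thesis unfolding graph_diameter_def by (intro SUP_least)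
qed

end
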